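(* Let $G$ be a connected finite simple graph with minimum degree $\delta(G) \geq 2$. Then: (i) if $G$ is an interval graph, $diam(G) \leq rc(G) \leq diam(G) + 1$; (ii) if $G$ is AT-free, $diam(G) \leq rc(G) \leq diam(G) + 3$; (iii) if $G$ is a threshold graph, $diam(G) \leq rc(G) \leq 3$; (iv) if $G$ is a chain graph, $diam(G) \leq rc(G) \leq 4$; (v) if $G$ is a circular arc graph, $diam(G) \leq rc(G) \leq diam(G) + 4$. Moreover, there exist interval graphs, threshold graphs and chain graphs, each connected with minimum degree at least $2$, whose rainbow connection number equals the corresponding upper bound above (for interval graphs: $rc(G)=diam(G)+1$; for threshold graphs: $rc(G)=3$; for chain graphs: $rc(G)=4$), and there exists a connected AT-free graph $G$ with minimum degree at least $2$ and $rc(G) = diam(G) + 2$.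
   Context: An edge-coloured graph is rainbow connected if every pair of vertices is joined by a path no two of whose edges have the same colour; the rainbow connection number $rc(G)$ of a connected graph $G$ is the minimum number of colours in an edge colouring making $G$ rainbow connected. $diam(G)$ is the maximum distance between two vertices. An interval graph is an intersection graph of intervals on the real line; a circular arc graph is an intersection graph of arcs on a circle. An independent triple of vertices $x,y,z$ is an asteroidal triple if between every pair of them there is a path containing no neighbour of the third; a graph is AT-free if it has no asteroidal triple. $G$ is a threshold graph if there are $w:V(G)\to\mathbb{R}$ and $t\in\mathbb{R}$ such that distinct $u,v$ are adjacent iff $w(u)+w(v)\geq t$. A bipartite graph $G(A,B)$ is a chain graph if $A$ can be ordered $a_1,\dots,a_k$ with $N(a_1)\subseteq N(a_2)\subseteq\cdots\subseteq N(a_k)$. *)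

theory Defs
  imports "HOL-Analysis.Analysis"
begin

text \<open>
  A graph is given by its vertex set \<open>V\<close> and its set \<open>E\<close> of edges, each edge being the
  unordered pair \<open>{u, v}\<close> of its ends.
\<close>

definition finite_simple_graph :: "'a set \<Rightarrow> 'a set set \<Rightarrow> bool" where
  "finite_simple_graph V E \<longleftrightarrow> finite V \<and> (\<forall>e\<in>E. e \<subseteq> V \<and> card e = 2)"

definition neighbours :: "'a set set \<Rightarrow> 'a \<Rightarrow> 'a set" where
  "neighbours E v = {u. {u, v} \<in> E}"

definition min_degree :: "'a set \<Rightarrow> 'a set set \<Rightarrow> nat" where
  "min_degree V E = Min ((\<lambda>v. card (neighbours E v)) ` V)"

definition path_between :: "'a set \<Rightarrow> 'a set set \<Rightarrow> 'a \<Rightarrow> 'a \<Rightarrow> 'a list \<Rightarrow> bool" where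
  "path_between V E u v p \<longleftrightarrow>
     p \<noteq> [] \<and> hd p = u \<and> last p = v \<and> set p \<subseteq> V \<and> distinct p \<and>
     successively (\<lambda>x y. {x, y} \<in> E) p"

definition path_edges :: "'a list \<Rightarrow> 'a set list" where
  "path_edges p = map (\<lambda>(x, y). {x, y}) (zip p (tl p))"

text \<open>A connected graph has at least one vertex, so that \<^const>\<open>min_degree\<close> and the diameter
  below are taken over nonempty finite sets.\<close>

definition connected_graph :: "'a set \<Rightarrow> 'a set set \<Rightarrow> bool" where
  "connected_graph V E \<longleftrightarrow> V \<noteq> {} \<and> (\<forall>u\<in>V. \<forall>v\<in>V. \<exists>p. path_between V E u v p)"

text \<open>Meaningful only if \<open>u\<close> and \<open>v\<close> are joined by a path.\<close>

definition graph_dist :: "'a set \<Rightarrow> 'a set set \<Rightarrow> 'a \<Rightarrow> 'a \<Rightarrow> nat" where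
  "graph_dist V E u v = (LEAST n. \<exists>p. path_between V E u v p \<and> length (path_edges p) = n)"

definition graph_diam :: "'a set \<Rightarrow> 'a set set \<Rightarrow> nat" where
  "graph_diam V E = Max {graph_dist V E u v |u v. u \<in> V \<and> v \<in> V}"

text \<open>An edge colouring is an arbitrary (not necessarily proper) map from edges to colours; two
  edges on a path have different colours iff the list of colours along the path is distinct.\<close>

definition rainbow_connected :: "'a set \<Rightarrow> 'a set set \<Rightarrow> ('a set \<Rightarrow> 'c) \<Rightarrow> bool" where
  "rainbow_connected V E c \<longleftrightarrow>
     (\<forall>u\<in>V. \<forall>v\<in>V. \<exists>p. path_between V E u v p \<and> distinct (map c (path_edges p)))"

text \<open>The number of colours used is the number of values taken on \<open>E\<close>. Natural numbers suffice
  as colours since \<open>E\<close> is finite.\<close>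

definition rainbow_connection_number :: "'a set \<Rightarrow> 'a set set \<Rightarrow> nat" where
  "rainbow_connection_number V E =
     (LEAST k. \<exists>c :: 'a set \<Rightarrow> nat. rainbow_connected V E c \<and> card (c ` E) = k)"

definition intersection_representation ::
    "'a set \<Rightarrow> 'a set set \<Rightarrow> ('a \<Rightarrow> 'b set) \<Rightarrow> bool" where
  "intersection_representation V E S \<longleftrightarrow>
     (\<forall>u\<in>V. \<forall>v\<in>V. u \<noteq> v \<longrightarrow> ({u, v} \<in> E \<longleftrightarrow> S u \<inter> S v \<noteq> {}))"

definition interval_graph :: "'a set \<Rightarrow> 'a set set \<Rightarrow> bool" where
  "interval_graph V E \<longleftrightarrow>
     (\<exists>S :: 'a \<Rightarrow> real set.
        (\<forall>v\<in>V. is_interval (S v) \<and> S v \<noteq> {}) \<and> intersection_representation V E S)"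

text \<open>Arcs of the unit circle are the images of real intervals under \<open>t \<mapsto> exp (i t)\<close>. Endpoints
  may or may not belong to an interval or arc, and the full circle counts as an arc; for finite
  graphs this does not affect which graphs can be represented.\<close>

definition circle_arc :: "complex set \<Rightarrow> bool" where
  "circle_arc A \<longleftrightarrow> (\<exists>J :: real set. is_interval J \<and> J \<noteq> {} \<and> A = cis ` J)"

definition circular_arc_graph :: "'a set \<Rightarrow> 'a set set \<Rightarrow> bool" where
  "circular_arc_graph V E \<longleftrightarrow>
     (\<exists>S :: 'a \<Rightarrow> complex set.
        (\<forall>v\<in>V. circle_arc (S v)) \<and> intersection_representation V E S)"

definition path_avoiding_neighbours ::
    "'a set \<Rightarrow> 'a set set \<Rightarrow> 'a \<Rightarrow> 'a \<Rightarrow> 'a \<Rightarrow> bool" where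
  "path_avoiding_neighbours V E x y z \<longleftrightarrow>
     (\<exists>p. path_between V E x y p \<and> set p \<inter> neighbours E z = {})"

definition asteroidal_triple :: "'a set \<Rightarrow> 'a set set \<Rightarrow> 'a \<Rightarrow> 'a \<Rightarrow> 'a \<Rightarrow> bool" where
  "asteroidal_triple V E x y z \<longleftrightarrow>
     x \<in> V \<and> y \<in> V \<and> z \<in> V \<and> x \<noteq> y \<and> y \<noteq> z \<and> x \<noteq> z \<and>
     {x, y} \<notin> E \<and> {y, z} \<notin> E \<and> {x, z} \<notin> E \<and>
     path_avoiding_neighbours V E x y z \<and>
     path_avoiding_neighbours V E y z x \<and>
     path_avoiding_neighbours V E x z y"

definition AT_free :: "'a set \<Rightarrow> 'a set set \<Rightarrow> bool" where
  "AT_free V E \<longleftrightarrow> (\<nexists>x y z. asteroidal_triple V E x y z)"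

definition threshold_graph :: "'a set \<Rightarrow> 'a set set \<Rightarrow> bool" where
  "threshold_graph V E \<longleftrightarrow>
     (\<exists>(w :: 'a \<Rightarrow> real) (t :: real).
        \<forall>u\<in>V. \<forall>v\<in>V. u \<noteq> v \<longrightarrow> ({u, v} \<in> E \<longleftrightarrow> w u + w v \<ge> t))"

definition bipartition :: "'a set \<Rightarrow> 'a set set \<Rightarrow> 'a set \<Rightarrow> 'a set \<Rightarrow> bool" where
  "bipartition V E A B \<longleftrightarrow>
     A \<union> B = V \<and> A \<inter> B = {} \<and> (\<forall>e\<in>E. \<exists>a\<in>A. \<exists>b\<in>B. e = {a, b})"

text \<open>The list \<open>as\<close> is the ordering of \<open>A\<close> by increasing neighbourhoods.\<close>

definition chain_graph :: "'a set \<Rightarrow> 'a set set \<Rightarrow> bool" where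
  "chain_graph V E \<longleftrightarrow>
     (\<exists>A B as. bipartition V E A B \<and> distinct as \<and> set as = A \<and>
        sorted_wrt (\<lambda>a a'. neighbours E a \<subseteq> neighbours E a') as)"

end

(*
A connected dominating set D, coloured with q colours so that any two of its vertices are joined by
a rainbow path inside D, gives a rainbow colouring of G with q + 3 colours: split the vertices outside
D by a maximal independent set of G - D, colour the edges towards D from the two parts with two new
colours and the edges outside D with a third. A vertex isolated in G - D has two edges towards D by
the degree condition and uses both colours. Each upper bound then needs a good D.

Interval graphs: the interior of a shortest path between the interval ending first and the interval
starting last. Threshold graphs: a vertex of maximum weight. Chain graphs: an edge between the last
vertex of A and a neighbour of the first. AT-free graphs: a shortest path between a dominating pair.
Circular arc graphs: cut the circle if possible; otherwise walk greedily once around the circle, which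
yields a dominating cycle whose antipodal vertices are far apart.

The extremal examples are K_{2,10} and the join of an edge with five isolated vertices: with too few
colours two of the leaves see the same colours at both hubs, which forces a longer path between them.
*)
theory Submission
  imports Defs
begin

subsection \<open>Walks and rainbow colourings\<close>

text \<open>Routes are glued from pieces that may share vertices, so the arguments use walks and
  return to paths by cutting out loops. A route is leg, rainbow piece inside D, leg. One end reaches
  D by at most one edge, whose colour cannot be prescribed; the other end must therefore be able to
  realise whichever of the two leg colours remains. The independent set, the third colour and the
  degree condition serve exactly this. A path D with e edges costs e + 3 colours. The interior of a
  shortest path has at most diam - 2 edges, which gives diam + 1; the path between a dominating pair
  gives diam + 3; a vertex and an edge give 3 and 4. On a cycle with m + 1 vertices, edges half a
  turn apart share a colour, so m div 2 + 1 colours suffice inside D, and a pair at distance at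
  least m div 2 turns this into diam + 4. A dominating pair \<open>x\<close>, \<open>y\<close> comes
  from two extremal choices: \<open>x\<close> maximises a weight that favours large components after
  deletion of its closed neighbourhood, and then \<open>y\<close> maximises the number of vertices
  whose closed neighbourhood meets every path from \<open>y\<close> to \<open>x\<close>.\<close>

definition walk_between :: "'a set \<Rightarrow> 'a set set \<Rightarrow> 'a \<Rightarrow> 'a \<Rightarrow> 'a list \<Rightarrow> bool" where
  "walk_between S E u v p \<longleftrightarrow>
     p \<noteq> [] \<and> hd p = u \<and> last p = v \<and> set p \<subseteq> S \<and> successively (\<lambda>x y. {x, y} \<in> E) p"

definition rainbow_joined ::
    "'a set \<Rightarrow> 'a set set \<Rightarrow> ('a set \<Rightarrow> 'c) \<Rightarrow> 'a \<Rightarrow> 'a \<Rightarrow> bool" where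
  "rainbow_joined S E c u v \<longleftrightarrow>
     (\<exists>p. walk_between S E u v p \<and> distinct (map c (path_edges p)))"

definition joined :: "'a set set \<Rightarrow> 'a set \<Rightarrow> 'a \<Rightarrow> 'a \<Rightarrow> bool" where
  "joined E S u v \<longleftrightarrow> (\<exists>p. walk_between S E u v p)"

lemma path_edges_simps [simp]:
  "path_edges [] = []" "path_edges [x] = []"
  "path_edges (x # y # p) = {x, y} # path_edges (y # p)"
  by (simp_all add: path_edges_def)

lemma length_path_edges [simp]: "length (path_edges p) = length p - 1"
  by (simp add: path_edges_def)

lemma path_edges_append:
  "path_edges (p @ x # q) = path_edges (p @ [x]) @ path_edges (x # q)"
proof (induction p)
  case (Cons a p)
  then show ?case by (cases p) auto
qed simp

lemma path_edges_join:
  assumes "p \<noteq> []" "q \<noteq> []" "last p = hd q"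
  shows "path_edges (p @ tl q) = path_edges p @ path_edges q"
proof -
  obtain p' x where p: "p = p' @ [x]" using assms(1) by (metis rev_exhaust)
  obtain q' where q: "q = x # q'" using assms p by (cases q) auto
  show ?thesis using path_edges_append[of p' x q'] p q by simp
qed

lemma path_edges_rev: "path_edges (rev p) = rev (path_edges p)"
proof (induction p)
  case (Cons a p)
  then show ?case
  proof (cases p)
    case (Cons b q)
    have "path_edges (rev (a # p)) = path_edges (rev q @ b # [a])" using Cons by simp
    also have "\<dots> = path_edges (rev q @ [b]) @ path_edges (b # [a])"
      by (rule path_edges_append)
    also have "rev q @ [b] = rev p" using Cons by simp
    finally show ?thesis using Cons Cons.IH by (simp add: insert_commute)
  qed simp
qed simp

lemma path_edges_subset: "e \<in> set (path_edges p) \<Longrightarrow> e \<subseteq> set p"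
  by (induction p rule: induct_list012) auto

lemma distinct_path_edges: "distinct p \<Longrightarrow> distinct (path_edges p)"
proof (induction p rule: induct_list012)
  case (3 x y zs)
  then show ?case using path_edges_subset[of "{x, y}" "y # zs"] by auto
qed auto

lemma path_edges_in_edges:
  "successively (\<lambda>x y. {x, y} \<in> E) p \<Longrightarrow> set (path_edges p) \<subseteq> E"
  by (induction p rule: induct_list012) auto

lemma path_imp_walk: "path_between S E u v p \<Longrightarrow> walk_between S E u v p"
  by (simp add: path_between_def walk_between_def)

lemma walk_refl: "u \<in> S \<Longrightarrow> walk_between S E u u [u]"
  by (simp add: walk_between_def)

lemma walk_edge: "\<lbrakk>u \<in> S; v \<in> S; {u, v} \<in> E\<rbrakk> \<Longrightarrow> walk_between S E u v [u, v]"
  by (simp add: walk_between_def)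

lemma walk_mono: "\<lbrakk>walk_between S E u v p; S \<subseteq> S'\<rbrakk> \<Longrightarrow> walk_between S' E u v p"
  by (auto simp: walk_between_def)

lemma walk_rev: "walk_between S E u v p \<Longrightarrow> walk_between S E v u (rev p)"
  by (auto simp: walk_between_def hd_rev last_rev insert_commute)

lemma walk_join:
  assumes "walk_between S E u v p" "walk_between S E v w q"
  shows "walk_between S E u w (p @ tl q)"
proof (cases "tl q")
  case Nil
  then have "v = w" using assms(2) by (cases q) (auto simp: walk_between_def)
  with Nil assms(1) show ?thesis by simp
next
  case (Cons b q')
  then have q: "q = v # b # q'" using assms(2) by (cases q) (auto simp: walk_between_def)
  show ?thesis using assms
    by (auto simp: q walk_between_def successively_append_iff)
qed

text \<open>The stretch between two occurrences of a vertex can be removed. The remaining edges form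
  a subsequence, so one and the same path stays rainbow for every colouring that made the walk
  rainbow.\<close>

lemma walk_shorten:
  assumes "walk_between S E u v p"
  shows "\<exists>p'. path_between S E u v p' \<and>
    (\<forall>c :: 'a set \<Rightarrow> 'c. distinct (map c (path_edges p)) \<longrightarrow> distinct (map c (path_edges p')))"
  using assms
proof (induction "length p" arbitrary: p rule: less_induct)
  case less
  show ?case
  proof (cases "distinct p")
    case True
    then show ?thesis using less.prems by (auto simp: walk_between_def path_between_def)
  next
    case False
    then obtain xs ys zs y where p: "p = xs @ [y] @ ys @ [y] @ zs"
      using not_distinct_decomp by blast
    let ?q = "xs @ y # zs"
    have "walk_between S E u v ?q"
      using less.prems
      by (auto simp: p walk_between_def successively_append_iff successively_Cons hd_append split: if_splits)
    then obtain p' where p': "path_between S E u v p'"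
      "\<forall>c :: 'a set \<Rightarrow> 'c. distinct (map c (path_edges ?q)) \<longrightarrow> distinct (map c (path_edges p'))"
      using less.hyps[of ?q] p by auto
    have "path_edges p = path_edges (xs @ [y]) @ path_edges (y # ys @ [y]) @ path_edges (y # zs)"
      using path_edges_append[of xs y "ys @ y # zs"] path_edges_append[of "y # ys" y zs]
      by (simp add: p)
    then have "distinct (map c (path_edges ?q))" if "distinct (map c (path_edges p))" for c :: "'a set \<Rightarrow> 'c"
      using that path_edges_append[of xs y zs] by auto
    then show ?thesis using p' by blast
  qed
qed

lemma joined_iff_path: "joined E S u v \<longleftrightarrow> (\<exists>p. path_between S E u v p)"
proof
  assume "joined E S u v"
  then obtain p where "walk_between S E u v p" by (auto simp: joined_def)
  from walk_shorten[OF this] show "\<exists>p. path_between S E u v p" by blast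
next
  assume "\<exists>p. path_between S E u v p"
  then show "joined E S u v" unfolding joined_def using path_imp_walk by fast
qed

lemma joined_refl: "u \<in> S \<Longrightarrow> joined E S u u"
  using walk_refl joined_def by metis

lemma joined_edge: "\<lbrakk>u \<in> S; v \<in> S; {u, v} \<in> E\<rbrakk> \<Longrightarrow> joined E S u v"
  using walk_edge joined_def by metis

lemma joined_sym: "joined E S u v \<Longrightarrow> joined E S v u"
  using walk_rev joined_def by metis

lemma joined_trans: "\<lbrakk>joined E S u v; joined E S v w\<rbrakk> \<Longrightarrow> joined E S u w"
  using walk_join joined_def by metis

lemma joined_in: "joined E S u v \<Longrightarrow> u \<in> S \<and> v \<in> S"
  by (auto simp: joined_def walk_between_def)

lemma walk_elem_joined:
  assumes "walk_between S E u v p" "w \<in> set p"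
  shows "joined E S u w"
proof -
  obtain xs ys where p: "p = xs @ w # ys" using assms(2) by (metis split_list)
  have "walk_between S E u w (xs @ [w])"
    using assms(1)
    by (auto simp: p walk_between_def successively_append_iff hd_append)
  then show ?thesis by (auto simp: joined_def)
qed

lemma rainbow_joined_refl: "u \<in> S \<Longrightarrow> rainbow_joined S E c u u"
  using walk_refl by (fastforce simp: rainbow_joined_def)

lemma rainbow_joined_sym:
  assumes "rainbow_joined S E c u v" shows "rainbow_joined S E c v u"
proof -
  obtain p where "walk_between S E u v p" "distinct (map c (path_edges p))"
    using assms by (auto simp: rainbow_joined_def)
  then have "walk_between S E v u (rev p) \<and> distinct (map c (path_edges (rev p)))"
    by (simp add: walk_rev path_edges_rev flip: rev_map)
  then show ?thesis by (auto simp: rainbow_joined_def)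
qed

lemma rainbow_connected_iff:
  "rainbow_connected V E c \<longleftrightarrow> (\<forall>u\<in>V. \<forall>v\<in>V. rainbow_joined V E c u v)"
  unfolding rainbow_connected_def rainbow_joined_def
  by (meson path_imp_walk walk_shorten)

section \<open>Distances, the diameter and numbers of colours\<close>

locale finite_graph =
  fixes V :: "'a set" and E :: "'a set set"
  assumes simple: "finite_simple_graph V E"
begin

lemma finite_V: "finite V" and edge_subset: "e \<in> E \<Longrightarrow> e \<subseteq> V" and edge_card: "e \<in> E \<Longrightarrow> card e = 2"
  using simple by (auto simp: finite_simple_graph_def)

lemma finite_E: "finite E"
  using edge_subset finite_V by (meson Pow_iff finite_Pow_iff finite_subset subsetI)

lemma edgeD: assumes "{u, v} \<in> E" shows "u \<in> V" "v \<in> V" "u \<noteq> v"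
  using edge_subset[OF assms] edge_card[OF assms] by (auto simp: card_insert_if)

lemma neighbours_subset: "neighbours E v \<subseteq> V"
  using edgeD by (auto simp: neighbours_def)

lemma graph_dist_le:
  assumes "path_between V E u v p"
  shows "graph_dist V E u v \<le> length p - 1"
  unfolding graph_dist_def by (rule Least_le) (use assms in auto)

lemma graph_dist_path:
  assumes "path_between V E u v p"
  shows "\<exists>p. path_between V E u v p \<and> length p - 1 = graph_dist V E u v"
  unfolding graph_dist_def
  by (rule LeastI2[where a = "length p - 1"]) (use assms in auto)

lemma graph_dist_le_diam:
  assumes "u \<in> V" "v \<in> V"
  shows "graph_dist V E u v \<le> graph_diam V E"
proof -
  have "{graph_dist V E u v |u v. u \<in> V \<and> v \<in> V} = (\<lambda>(u, v). graph_dist V E u v) ` (V \<times> V)"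
    by auto
  then have "finite {graph_dist V E u v |u v. u \<in> V \<and> v \<in> V}"
    by (simp add: finite_V)
  then show ?thesis unfolding graph_diam_def by (rule Max_ge) (use assms in auto)
qed

lemma graph_diam_le:
  assumes "V \<noteq> {}" "\<And>u v. \<lbrakk>u \<in> V; v \<in> V\<rbrakk> \<Longrightarrow> graph_dist V E u v \<le> k"
  shows "graph_diam V E \<le> k"
proof -
  have "{graph_dist V E u v |u v. u \<in> V \<and> v \<in> V} = (\<lambda>(u, v). graph_dist V E u v) ` (V \<times> V)"
    by auto
  then have "finite {graph_dist V E u v |u v. u \<in> V \<and> v \<in> V}"
    by (simp add: finite_V)
  moreover have "{graph_dist V E u v |u v. u \<in> V \<and> v \<in> V} \<noteq> {}" using assms(1) by blast
  ultimately show ?thesis unfolding graph_diam_def by (subst Max_le_iff) (use assms(2) in auto)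
qed

text \<open>Each edge of a rainbow path spends its own colour. This gives the diameter bound and
  also the lower bounds for the extremal examples.\<close>

lemma rainbow_path_length:
  assumes "path_between V E u v p" "distinct (map c (path_edges p))"
  shows "length p - 1 \<le> card (c ` E)"
proof -
  have "length p - 1 = card (set (map c (path_edges p)))"
    using distinct_card[OF assms(2)] by simp
  also have "\<dots> \<le> card (c ` E)"
    by (rule card_mono)
      (use path_edges_in_edges[of E p] assms(1) finite_E in \<open>auto simp: path_between_def\<close>)
  finally show ?thesis .
qed

text \<open>The given colouring ensures that the \<open>LEAST\<close> in the definition is attained;
  the optimal colouring so obtained then bounds every distance.\<close>

lemma rainbow_colouring_bounds:
  fixes c :: "'a set \<Rightarrow> nat"
  assumes "V \<noteq> {}" "rainbow_connected V E c" "card (c ` E) \<le> k"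
  shows "graph_diam V E \<le> rainbow_connection_number V E \<and> rainbow_connection_number V E \<le> k"
proof
  let ?P = "\<lambda>k. \<exists>c :: 'a set \<Rightarrow> nat. rainbow_connected V E c \<and> card (c ` E) = k"
  have P: "?P (card (c ` E))" using assms by blast
  show "rainbow_connection_number V E \<le> k"
    unfolding rainbow_connection_number_def using Least_le[of ?P, OF P] assms(3) by linarith
  obtain c' :: "'a set \<Rightarrow> nat" where c': "rainbow_connected V E c'"
    "card (c' ` E) = rainbow_connection_number V E"
    unfolding rainbow_connection_number_def using LeastI[of ?P, OF P] by blast
  show "graph_diam V E \<le> rainbow_connection_number V E"
  proof (rule graph_diam_le[OF assms(1)])
    fix u v assume "u \<in> V" "v \<in> V"
    then obtain p where p: "path_between V E u v p" "distinct (map c' (path_edges p))"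
      using c'(1) by (auto simp: rainbow_connected_def)
    show "graph_dist V E u v \<le> rainbow_connection_number V E"
      using graph_dist_le[OF p(1)] rainbow_path_length[OF p] c'(2) by linarith
  qed
qed

end

locale connected_min_degree_2 = finite_graph +
  assumes conn: "connected_graph V E" and min_deg: "min_degree V E \<ge> 2"
begin

lemma nonempty: "V \<noteq> {}" using conn by (simp add: connected_graph_def)

lemma degree_ge: "v \<in> V \<Longrightarrow> card (neighbours E v) \<ge> 2"
proof -
  assume "v \<in> V"
  then have "min_degree V E \<le> card (neighbours E v)"
    unfolding min_degree_def by (intro Min_le) (use finite_V in auto)
  then show ?thesis using min_deg by linarith
qed

lemma ex_neighbour: "v \<in> V \<Longrightarrow> \<exists>u. {v, u} \<in> E \<and> u \<noteq> w"
proof -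
  assume "v \<in> V"
  then have "\<not> neighbours E v \<subseteq> {w}"
    using degree_ge[of v] card_mono[of "{w}" "neighbours E v"] by auto
  then show ?thesis by (auto simp: neighbours_def insert_commute)
qed

lemma ex_rainbow_colouring: "\<exists>c :: 'a set \<Rightarrow> nat. rainbow_connected V E c"
proof -
  obtain c :: "'a set \<Rightarrow> nat" where inj: "inj_on c E"
    using finite_imp_inj_to_nat_seg[OF finite_E] by blast
  have "distinct (map c (path_edges p))" if "path_between V E u v p" for u v p
    unfolding distinct_map using that
    by (auto simp: path_between_def intro!: distinct_path_edges inj_on_subset[OF inj] dest: path_edges_in_edges)
  then have "rainbow_connected V E c"
    using conn unfolding rainbow_connected_def connected_graph_def by meson
  then show ?thesis by blast
qed

text \<open>A \<open>LEAST\<close> can be bounded below only if it is attained, hence the appeal to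
  an injective colouring.\<close>

lemma rainbow_connection_number_ge:
  assumes "\<And>c :: 'a set \<Rightarrow> nat. rainbow_connected V E c \<Longrightarrow> k \<le> card (c ` E)"
  shows "k \<le> rainbow_connection_number V E"
proof -
  let ?P = "\<lambda>k. \<exists>c :: 'a set \<Rightarrow> nat. rainbow_connected V E c \<and> card (c ` E) = k"
  obtain c :: "'a set \<Rightarrow> nat" where "rainbow_connected V E c" using ex_rainbow_colouring by blast
  then have "?P (card (c ` E))" by blast
  then have "?P (rainbow_connection_number V E)"
    unfolding rainbow_connection_number_def by (rule LeastI[of ?P])
  then show ?thesis using assms by metis
qed

text \<open>The inner colouring stays below \<open>q\<close>, which leaves \<open>q\<close> and
  \<open>q + 1\<close> for edges towards \<open>D\<close> and \<open>q + 2\<close> for edges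
  outside; the stretches of a route can then be separated by colour ranges alone.\<close>

lemma rainbow_three_extra_colours:
  fixes c0 :: "'a set \<Rightarrow> nat"
  assumes D: "D \<subseteq> V" "\<And>v. v \<in> V - D \<Longrightarrow> \<exists>d\<in>D. {v, d} \<in> E"
    and bound: "\<And>e. \<lbrakk>e \<in> E; e \<subseteq> D\<rbrakk> \<Longrightarrow> c0 e < q"
    and rb: "\<And>u v. \<lbrakk>u \<in> D; v \<in> D\<rbrakk> \<Longrightarrow> rainbow_joined D E c0 u v"
  shows "\<exists>c :: 'a set \<Rightarrow> nat. rainbow_connected V E c \<and> card (c ` E) \<le> q + 3"
proof -
  define H where "H = V - D"
  define indep where "indep X \<longleftrightarrow> X \<subseteq> H \<and> (\<forall>x\<in>X. \<forall>y\<in>X. {x, y} \<notin> E)" for X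
  have fin: "finite {X. indep X}"
    by (rule finite_subset[of _ "Pow V"]) (auto simp: indep_def H_def finite_V)
  have "indep {}" by (simp add: indep_def)
  then obtain X where X: "indep X" and max: "\<And>Y. \<lbrakk>indep Y; X \<subseteq> Y\<rbrakk> \<Longrightarrow> Y = X"
    using finite_has_maximal[OF fin] by (metis empty_iff mem_Collect_eq)
  define iso where "iso x \<longleftrightarrow> (\<forall>y\<in>H. {x, y} \<notin> E)" for x
  define foot where "foot x = (SOME d. d \<in> D \<and> {x, d} \<in> E)" for x
  have foot: "foot x \<in> D" "{x, foot x} \<in> E" if "x \<in> H" for x
    using someI_ex[of "\<lambda>d. d \<in> D \<and> {x, d} \<in> E"] D(2)[of x] that
    unfolding foot_def H_def by auto
  \<comment> \<open>\<open>A\<close> is the colour class \<open>q\<close>. An isolated member of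
    \<open>X\<close> gives only its foot edge to it, so that its other edges supply
    \<open>q + 1\<close>.\<close>
  define A where "A = {{x, d} |x d. x \<in> X \<and> d \<in> D \<and> (iso x \<longrightarrow> d = foot x)}"
  define c where "c e = (if e \<subseteq> D then c0 e else if e \<inter> D = {} then q + 2
      else if e \<in> A then q else q + 1)" for e
  have XH: "X \<subseteq> H" using X by (simp add: indep_def)
  have leg: "c {x, d} = (if x \<in> X \<and> (iso x \<longrightarrow> d = foot x) then q else q + 1)"
    if "x \<in> H" "d \<in> D" for x d
    using that XH by (auto simp: c_def A_def H_def doubleton_eq_iff)
  have outer: "c {x, y} = q + 2" if "x \<in> H" "y \<in> H" for x y
    using that by (auto simp: c_def H_def)
  \<comment> \<open>For a non-isolated \<open>x\<close> in \<open>X\<close>, independence puts each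
    outer neighbour outside \<open>X\<close>; for \<open>x\<close> outside \<open>X\<close>,
    maximality supplies a neighbour in \<open>X\<close>.\<close>
  have opposite: "\<exists>y\<in>H. {x, y} \<in> E \<and> (y \<in> X \<longleftrightarrow> x \<notin> X) \<and> \<not> iso y"
    if x: "x \<in> H" "\<not> (x \<in> X \<and> iso x)" for x
  proof (cases "x \<in> X")
    case True
    then show ?thesis using x X unfolding indep_def iso_def
      by (metis insert_commute)
  next
    case False
    then have "\<not> indep (insert x X)" using max[of "insert x X"] by auto
    then obtain y where "y \<in> X" "{x, y} \<in> E"
      using X x(1) edgeD(3)[of x x] unfolding indep_def by (auto simp: insert_commute)
    then show ?thesis using XH x False unfolding iso_def by (metis insert_commute subsetD)
  qed
  text \<open>Two vertices get connected through \<open>D\<close> by taking \<open>near\<close> for one and \<open>far\<close> for the other,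
    with complementary \<open>\<gamma>\<close>; only one of them then uses the colour \<open>q + 2\<close>.\<close>
  have near: "\<exists>d\<in>D. \<exists>p \<gamma>. walk_between V E x d p \<and> distinct (map c (path_edges p)) \<and>
      \<gamma> \<in> {q, q + 1} \<and> set (map c (path_edges p)) \<subseteq> {\<gamma>}" if "x \<in> V" for x
  proof (cases "x \<in> D")
    case True
    then show ?thesis using that by (intro bexI[of _ x] exI[of _ "[x]"] exI[of _ q]) (auto simp: walk_refl)
  next
    case False
    then have "x \<in> H" using that by (simp add: H_def)
    then show ?thesis using foot[of x] leg[of x "foot x"] D
      by (intro bexI[of _ "foot x"] exI[of _ "[x, foot x]"] exI[of _ "c {x, foot x}"])
        (auto intro!: walk_edge simp: H_def)
  qed
  \<comment> \<open>Without an own edge of colour \<open>\<gamma>\<close> towards \<open>D\<close>,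
    cross to a vertex on the other side of the partition: its foot edge does not have the colour of
    the foot edge of \<open>x\<close>, so it has colour \<open>\<gamma>\<close>.\<close>
  have far: "\<exists>d\<in>D. \<exists>p. walk_between V E x d p \<and> distinct (map c (path_edges p)) \<and>
      set (map c (path_edges p)) \<subseteq> {\<gamma>, q + 2}" if "x \<in> V" and \<gamma>: "\<gamma> \<in> {q, q + 1}" for x \<gamma>
  proof (cases "x \<in> D")
    case True
    then show ?thesis using that by (intro bexI[of _ x] exI[of _ "[x]"]) (auto simp: walk_refl)
  next
    case False
    then have x: "x \<in> H" using that by (simp add: H_def)
    show ?thesis
    proof (cases "\<exists>d\<in>D. {x, d} \<in> E \<and> c {x, d} = \<gamma>")
      case True
      then obtain d where "d \<in> D" "{x, d} \<in> E" "c {x, d} = \<gamma>" by blast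
      then show ?thesis using D \<open>x \<in> V\<close>
        by (intro bexI[of _ d] exI[of _ "[x, d]"]) (auto intro!: walk_edge)
    next
      case no: False
      \<comment> \<open>An isolated member of \<open>X\<close> has all its neighbours in
        \<open>D\<close>; its foot edge and a second edge show both leg colours.\<close>
      have "\<not> (x \<in> X \<and> iso x)"
      proof
        assume xX: "x \<in> X \<and> iso x"
        obtain d where d: "{x, d} \<in> E" "d \<noteq> foot x" using ex_neighbour[OF \<open>x \<in> V\<close>] by blast
        then have "d \<in> D" using xX edgeD(2)[OF d(1)] by (auto simp: iso_def H_def)
        then show False using no leg[OF x] foot[OF x] d xX \<gamma> by auto
      qed
      then obtain y where y: "y \<in> H" "{x, y} \<in> E" "y \<in> X \<longleftrightarrow> x \<notin> X" "\<not> iso y"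
        using opposite x by blast
      have "c {y, foot y} \<noteq> c {x, foot x}"
        using leg[OF x foot(1)[OF x]] leg[OF y(1) foot(1)[OF y(1)]] y(3) by auto
      moreover have "c {x, foot x} \<noteq> \<gamma>" using no foot[OF x] by blast
      ultimately have cy: "c {y, foot y} = \<gamma>"
        using leg[OF x foot(1)[OF x]] leg[OF y(1) foot(1)[OF y(1)]] \<gamma> by (auto split: if_splits)
      have "walk_between V E x (foot y) [x, y, foot y]"
        using x y foot[OF y(1)] D by (auto simp: walk_between_def H_def)
      moreover have "map c (path_edges [x, y, foot y]) = [q + 2, \<gamma>]"
        using outer[OF x y(1)] cy by simp
      ultimately show ?thesis using foot(1)[OF y(1)] \<gamma>
        by (intro bexI[of _ "foot y"] exI[of _ "[x, y, foot y]"]) auto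
    qed
  qed
  have "rainbow_joined V E c u v" if "u \<in> V" "v \<in> V" for u v
  proof -
    obtain d p \<gamma> where p: "d \<in> D" "walk_between V E u d p" "distinct (map c (path_edges p))"
      "\<gamma> \<in> {q, q + 1}" "set (map c (path_edges p)) \<subseteq> {\<gamma>}"
      using near[OF \<open>u \<in> V\<close>] by blast
    \<comment> \<open>\<open>2 * q + 1 - \<gamma>\<close> exchanges \<open>q\<close> and
      \<open>q + 1\<close>.\<close>
    obtain d' p' where p': "d' \<in> D" "walk_between V E v d' p'" "distinct (map c (path_edges p'))"
      "set (map c (path_edges p')) \<subseteq> {2 * q + 1 - \<gamma>, q + 2}"
      using far[OF \<open>v \<in> V\<close>, of "2 * q + 1 - \<gamma>"] p(4) by auto
    obtain r where r: "walk_between D E d d' r" "distinct (map c0 (path_edges r))"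
      using rb[OF p(1) p'(1)] by (auto simp: rainbow_joined_def)
    have eq: "map c (path_edges r) = map c0 (path_edges r)"
    proof (rule map_cong[OF refl])
      fix e assume "e \<in> set (path_edges r)"
      then have "e \<subseteq> D" using r(1) path_edges_subset[of e r] unfolding walk_between_def by blast
      then show "c e = c0 e" by (simp add: c_def)
    qed
    have "c0 ` set (path_edges r) \<subseteq> {..<q}"
      using r(1) path_edges_subset[of _ r] path_edges_in_edges[of E r] bound
      by (auto simp: walk_between_def subset_iff)
    then have r': "distinct (map c (path_edges r))" "set (map c (path_edges r)) \<subseteq> {..<q}"
      using r(2) by (simp_all only: eq set_map)
    have rV: "walk_between V E d d' r" using walk_mono[OF r(1) D(1)] .
    let ?w = "(p @ tl r) @ tl (rev p')"
    have w: "walk_between V E u d' (p @ tl r)" by (rule walk_join[OF p(2) rV])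
    have ww: "walk_between V E u v ?w" by (rule walk_join[OF w walk_rev[OF p'(2)]])
    have "p \<noteq> []" "r \<noteq> []" "last p = hd r" "p' \<noteq> []" "last (p @ tl r) = hd (rev p')"
      using p(2) r(1) w walk_rev[OF p'(2)] by (simp_all add: walk_between_def)
    then have edges_w: "path_edges ?w = path_edges p @ path_edges r @ rev (path_edges p')"
      using path_edges_join[of p r] path_edges_join[of "p @ tl r" "rev p'"]
      by (simp add: path_edges_rev)
    have "{\<gamma>} \<inter> {..<q} = {}" "{2 * q + 1 - \<gamma>, q + 2} \<inter> {..<q} = {}"
      "{\<gamma>} \<inter> {2 * q + 1 - \<gamma>, q + 2} = {}" using p(4) by auto
    then have "set (map c (path_edges p)) \<inter> set (map c (path_edges r)) = {}"
      "set (map c (path_edges p)) \<inter> set (map c (path_edges p')) = {}"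
      "set (map c (path_edges r)) \<inter> set (map c (path_edges p')) = {}"
      by (meson disjoint_iff p(5) p'(4) r'(2) subsetD)+
    then have "distinct (map c (path_edges ?w))"
      using p(3) p'(3) r'(1) 
      by (simp only: edges_w map_append distinct_append set_append rev_map[symmetric] distinct_rev
          set_rev Int_Un_distrib Un_empty simp_thms)
    then show ?thesis using ww by (auto simp: rainbow_joined_def)
  qed
  then have "rainbow_connected V E c" by (simp add: rainbow_connected_iff)
  moreover have "c ` E \<subseteq> {..<q + 3}" using bound by (fastforce simp: c_def)
  then have "card (c ` E) \<le> q + 3" using card_mono[of "{..<q+3}"] by fastforce
  ultimately show ?thesis by blast
qed

end

subsection \<open>Dominating paths\<close>

lemma path_edges_infix: "set (path_edges q) \<subseteq> set (path_edges (xs @ q @ ys))"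
proof -
  have right: "set (path_edges q) \<subseteq> set (path_edges (q @ ys))"
  proof (cases q rule: rev_cases)
    case (snoc q' x)
    then show ?thesis using path_edges_append[of q' x ys] by simp
  qed simp
  have left: "set (path_edges r) \<subseteq> set (path_edges (xs @ r))" for r :: "'a list"
  proof (induction xs)
    case (Cons a xs)
    then show ?case by (cases "xs @ r") auto
  qed simp
  show ?thesis using left[of "q @ ys"] right by blast
qed

lemma ex_infix_between:
  assumes "u \<in> set p" "v \<in> set p"
  shows "\<exists>xs q ys. p = xs @ q @ ys \<and> q \<noteq> [] \<and> (hd q = u \<and> last q = v \<or> hd q = v \<and> last q = u)"
proof -
  obtain xs ys where p: "p = xs @ u # ys" using assms(1) by (metis split_list)
  consider "v = u" | "v \<in> set xs" | "v \<in> set ys" using assms(2) p by auto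
  then show ?thesis
  proof cases
    case 1
    then show ?thesis using p by (intro exI[of _ xs] exI[of _ "[u]"] exI[of _ ys]) simp
  next
    case 2
    then obtain as bs where "xs = as @ v # bs" by (metis split_list)
    then show ?thesis using p
      by (intro exI[of _ as] exI[of _ "v # bs @ [u]"] exI[of _ ys]) simp
  next
    case 3
    then obtain as bs where "ys = as @ v # bs" by (metis split_list)
    then show ?thesis using p
      by (intro exI[of _ xs] exI[of _ "u # as @ [v]"] exI[of _ bs]) simp
  qed
qed

context connected_min_degree_2
begin

lemma ex_maximum:
  fixes f :: "'a \<Rightarrow> 'b :: linorder"
  shows "\<exists>z\<in>V. \<forall>v\<in>V. f v \<le> f z"
proof -
  have "Max (f ` V) \<in> f ` V" by (rule Max_in) (use finite_V nonempty in auto)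
  then obtain z where "z \<in> V" "f z = Max (f ` V)" by (metis imageE)
  then show ?thesis using finite_V by (intro bexI[of _ z]) simp_all
qed

text \<open>Colouring each edge of \<open>p\<close> by its position makes every infix rainbow, and
  any two vertices of \<open>p\<close> are the ends of an infix.\<close>

lemma rainbow_dominating_path:
  assumes p: "path_between V E a b p"
    and dom: "\<And>v. v \<in> V - set p \<Longrightarrow> \<exists>d\<in>set p. {v, d} \<in> E"
  shows "\<exists>c :: 'a set \<Rightarrow> nat. rainbow_connected V E c \<and> card (c ` E) \<le> length p + 2"
proof -
  define n where "n = length p - 1"
  have len: "length p = Suc n" using p by (cases p) (auto simp: n_def path_between_def)
  \<comment> \<open>Chords of \<open>p\<close> receive the default 0; no route uses them.\<close>
  define c0 where "c0 e = (if e \<in> set (path_edges p) then LEAST i. i < n \<and> path_edges p ! i = e else 0)" for e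
  have c0: "c0 e < n \<and> path_edges p ! c0 e = e" if e: "e \<in> set (path_edges p)" for e
  proof -
    have "\<exists>i. i < n \<and> path_edges p ! i = e" using e by (auto simp: in_set_conv_nth n_def)
    from LeastI_ex[OF this] show ?thesis using e by (simp add: c0_def)
  qed
  have inj: "inj_on c0 (set (path_edges p))" using c0 by (metis inj_onI)
  have "\<exists>c :: 'a set \<Rightarrow> nat. rainbow_connected V E c \<and> card (c ` E) \<le> n + 3"
  proof (rule rainbow_three_extra_colours[of "set p" c0])
    show "set p \<subseteq> V" using p by (simp add: path_between_def)
    show "\<exists>d\<in>set p. {v, d} \<in> E" if "v \<in> V - set p" for v using dom that by blast
    \<comment> \<open>The default 0 has to lie below \<open>n\<close>: an edge inside
      \<open>set p\<close> forces at least two vertices.\<close>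
    show "c0 e < n" if e: "e \<in> E" "e \<subseteq> set p" for e
    proof -
      have "2 \<le> card (set p)" using edge_card[OF e(1)] card_mono[OF _ e(2)] by simp
      then have "0 < n" using card_length[of p] len by linarith
      then show ?thesis using c0[of e] by (cases "e \<in> set (path_edges p)") (auto simp: c0_def)
    qed
    fix u v assume uv: "u \<in> set p" "v \<in> set p"
    then obtain xs q ys where q: "p = xs @ q @ ys" "q \<noteq> []"
        "hd q = u \<and> last q = v \<or> hd q = v \<and> last q = u"
      using ex_infix_between[OF uv] by metis
    have "walk_between (set p) E (hd q) (last q) q"
      using p q(2) by (simp add: walk_between_def path_between_def q(1) successively_append_iff subset_iff)
    moreover have "distinct q" using p q(1) by (simp add: path_between_def)
    then have "distinct (map c0 (path_edges q))"
      unfolding distinct_map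
      by (intro conjI distinct_path_edges inj_on_subset[OF inj]) (simp_all add: q(1) path_edges_infix)
    ultimately have "rainbow_joined (set p) E c0 (hd q) (last q)" by (auto simp: rainbow_joined_def)
    then show "rainbow_joined (set p) E c0 u v" using q(3) rainbow_joined_sym by metis
  qed
  then show ?thesis using len by (simp add: eval_nat_numeral)
qed

lemma dominating_path_bounds:
  assumes "path_between V E a b p" "\<And>v. v \<in> V - set p \<Longrightarrow> \<exists>d\<in>set p. {v, d} \<in> E"
    "length p + 2 \<le> k"
  shows "graph_diam V E \<le> rainbow_connection_number V E \<and> rainbow_connection_number V E \<le> k"
proof -
  obtain c :: "'a set \<Rightarrow> nat" where "rainbow_connected V E c" "card (c ` E) \<le> length p + 2"
    using rainbow_dominating_path[OF assms(1,2)] by blast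
  then show ?thesis using rainbow_colouring_bounds[OF nonempty, of c k] assms(3) by linarith
qed

lemma universal_vertex_bounds:
  assumes "z \<in> V" "\<And>v. \<lbrakk>v \<in> V; v \<noteq> z\<rbrakk> \<Longrightarrow> {v, z} \<in> E" "3 \<le> k"
  shows "graph_diam V E \<le> rainbow_connection_number V E \<and> rainbow_connection_number V E \<le> k"
  by (rule dominating_path_bounds[of z z "[z]"]) (use assms in \<open>auto simp: path_between_def\<close>)

section \<open>Threshold graphs and chain graphs\<close>

lemma threshold_bounds:
  assumes "threshold_graph V E"
  shows "graph_diam V E \<le> rainbow_connection_number V E \<and> rainbow_connection_number V E \<le> 3"
proof -
  obtain w :: "'a \<Rightarrow> real" and t where wt:
    "\<And>u v. \<lbrakk>u \<in> V; v \<in> V; u \<noteq> v\<rbrakk> \<Longrightarrow> {u, v} \<in> E \<longleftrightarrow> w u + w v \<ge> t"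
    using assms unfolding threshold_graph_def by blast
  obtain z where z: "z \<in> V" and max: "\<And>v. v \<in> V \<Longrightarrow> w v \<le> w z"
    using ex_maximum[of w] by blast
  show ?thesis
  proof (rule universal_vertex_bounds[OF z])
    fix v assume v: "v \<in> V" "v \<noteq> z"
    obtain u where u: "{v, u} \<in> E" using ex_neighbour[OF v(1)] by blast
    then have "w v + w u \<ge> t" using wt edgeD[OF u] by blast
    \<comment> \<open>\<open>z\<close> is at least as heavy as the neighbour \<open>u\<close> of
      \<open>v\<close>, so it can replace \<open>u\<close>.\<close>
    then have "w v + w z \<ge> t" using max[of u] edgeD[OF u] by simp
    then show "{v, z} \<in> E" using wt v z by blast
  qed simp
qed

text \<open>Nested neighbourhoods make \<open>last as\<close> adjacent to every vertex of
  \<open>B\<close>, each of which has some neighbour in \<open>A\<close>, and make a neighbour of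
  \<open>hd as\<close> adjacent to all of \<open>A\<close>.\<close>

lemma chain_bounds:
  assumes "chain_graph V E"
  shows "graph_diam V E \<le> rainbow_connection_number V E \<and> rainbow_connection_number V E \<le> 4"
proof -
  obtain A B as where bip: "bipartition V E A B" and as: "set as = A"
    and nest: "sorted_wrt (\<lambda>a a'. neighbours E a \<subseteq> neighbours E a') as"
    using assms unfolding chain_graph_def by blast
  have ends: "\<exists>a\<in>A. \<exists>b\<in>B. e = {a, b}" if "e \<in> E" for e
    using bip that by (auto simp: bipartition_def)
  have AB: "A \<union> B = V" "A \<inter> B = {}" using bip by (auto simp: bipartition_def)
  obtain z where "z \<in> V" using nonempty by blast
  then obtain z' where "{z, z'} \<in> E" using ex_neighbour by blast
  then have "as \<noteq> []" using ends as by fastforce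
  have last: "neighbours E a \<subseteq> neighbours E (last as)" if "a \<in> A" for a
  proof -
    obtain xs where xs: "as = xs @ [last as]" using \<open>as \<noteq> []\<close> by (metis append_butlast_last_id)
    then have "sorted_wrt (\<lambda>a a'. neighbours E a \<subseteq> neighbours E a') (xs @ [last as])" using nest by simp
    moreover have "a \<in> set xs \<or> a = last as" using that as xs by (metis Un_iff set_append empty_iff empty_set insert_iff list.simps(15))
    ultimately show ?thesis by (auto simp: sorted_wrt_append)
  qed
  have first: "neighbours E (hd as) \<subseteq> neighbours E a" if "a \<in> A" for a
    using nest that as \<open>as \<noteq> []\<close> by (cases as) auto
  have mem: "hd as \<in> A" "last as \<in> A" using \<open>as \<noteq> []\<close> as by auto
  have other: "v \<in> B" if "{u, v} \<in> E" "u \<in> A" for u v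
    using ends[OF that(1)] that(2) AB(2) by (auto simp: doubleton_eq_iff)
  obtain b where b: "{hd as, b} \<in> E" using ex_neighbour[of "hd as"] mem AB by auto
  have adj_b: "{a, b} \<in> E" if "a \<in> A" for a
    using first[OF that] b by (auto simp: neighbours_def insert_commute)
  show ?thesis
  proof (rule dominating_path_bounds[of "last as" b "[last as, b]"])
    have "{last as, b} \<in> E" using adj_b mem by blast
    then show "path_between V E (last as) b [last as, b]"
      using edgeD[of "last as" b] by (auto simp: path_between_def)
    fix v assume "v \<in> V - set [last as, b]"
    then consider "v \<in> A" | "v \<in> B" "v \<in> V" using AB by blast
    then show "\<exists>d\<in>set [last as, b]. {v, d} \<in> E"
    proof cases
      case 1 then show ?thesis using adj_b by auto
    next
      case 2
      obtain u where u: "{v, u} \<in> E" using ex_neighbour 2 by blast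
      then have "u \<in> A" using ends[OF u] 2 AB(2) by (auto simp: doubleton_eq_iff)
      then have "{v, last as} \<in> E" using last[of u] u by (auto simp: neighbours_def)
      then show ?thesis by auto
    qed
  qed simp
qed

section \<open>Complete graphs and interval graphs\<close>

lemma complete_bounds:
  assumes "\<And>u v. \<lbrakk>u \<in> V; v \<in> V; u \<noteq> v\<rbrakk> \<Longrightarrow> {u, v} \<in> E"
  shows "graph_diam V E \<le> rainbow_connection_number V E \<and> rainbow_connection_number V E \<le> 1"
proof (rule rainbow_colouring_bounds[OF nonempty, of "\<lambda>_. 0"])
  show "rainbow_connected V E (\<lambda>_. 0 :: nat)"
    unfolding rainbow_connected_iff
  proof (intro ballI)
    fix u v assume uv: "u \<in> V" "v \<in> V"
    show "rainbow_joined V E (\<lambda>_. 0 :: nat) u v"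
    proof (cases "u = v")
      case True
      then show ?thesis using rainbow_joined_refl uv by metis
    next
      case False
      then show ?thesis using walk_edge[OF uv assms[OF uv False]] by (fastforce simp: rainbow_joined_def)
    qed
  qed
  show "card ((\<lambda>_. 0 :: nat) ` E) \<le> 1" 
    using card_mono[of "{0}" "(\<lambda>_. 0 :: nat) ` E"] by auto
qed

end

text \<open>Shrinking every piece to the hull of finitely many chosen common points makes the
  representing intervals closed.\<close>

lemma closed_representation:
  fixes J :: "'a \<Rightarrow> real set" and f :: "real \<Rightarrow> 'b"
  assumes "finite V" "\<And>v. v \<in> V \<Longrightarrow> is_interval (J v)" "\<And>v. v \<in> V \<Longrightarrow> J v \<noteq> {}"
    and rep: "intersection_representation V E (\<lambda>v. f ` J v)"
  shows "\<exists>l r. (\<forall>v\<in>V. l v \<le> r v) \<and> intersection_representation V E (\<lambda>v. f ` {l v..r v})"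
proof -
  define meet where "meet u v a b \<longleftrightarrow> a \<in> J u \<and> b \<in> J v \<and> f a = f b" for u v a b
  \<comment> \<open>The choice depends on \<open>u\<close> and \<open>v\<close> only, so finitely
    many points are selected. The map \<open>f\<close> will be the identity for intervals and
    \<open>cis\<close> for arcs.\<close>
  define g where "g u v = (SOME z. meet u v (fst z) (snd z))" for u v
  define a where "a u v = fst (g u v)" for u v
  define b where "b u v = snd (g u v)" for u v
  have ab: "meet u v (a u v) (b u v)" if "meet u v x y" for u v x y
    using someI[of "\<lambda>z. meet u v (fst z) (snd z)" "(x, y)"] that by (simp add: a_def b_def g_def)
  \<comment> \<open>The restriction to \<open>J v\<close> discards arbitrary values of
    \<open>a\<close> and \<open>b\<close> at pairs without a common point.\<close>
  define Q where "Q v = {x \<in> J v. x \<in> (\<lambda>u. a v u) ` V \<union> (\<lambda>u. b u v) ` V}" for v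
  have self: "a v v \<in> Q v" if v: "v \<in> V" for v
  proof -
    obtain x where "x \<in> J v" using assms(3) v by blast
    then have "meet v v (a v v) (b v v)" using ab[of v v x x] by (simp add: meet_def)
    then show ?thesis using v by (auto simp: Q_def meet_def)
  qed
  have fin: "finite (Q v)" for v
    by (rule finite_subset[of _ "(\<lambda>u. a v u) ` V \<union> (\<lambda>u. b u v) ` V"]) (auto simp: Q_def assms(1))
  have ne: "Q v \<noteq> {}" if "v \<in> V" for v using self[OF that] by blast
  define l where "l v = Min (Q v)" for v
  define r where "r v = Max (Q v)" for v
  have in_hull: "x \<in> {l v..r v}" if "x \<in> Q v" for x v
    using that fin by (auto simp: l_def r_def)
  have hull: "{l v..r v} \<subseteq> J v" if v: "v \<in> V" for v
  proof
    fix x assume "x \<in> {l v..r v}"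
    moreover have "l v \<in> J v" "r v \<in> J v"
      using Min_in[OF fin ne[OF v]] Max_in[OF fin ne[OF v]] by (auto simp: l_def r_def Q_def)
    ultimately show "x \<in> J v" using assms(2)[OF v] by (meson atLeastAtMost_iff mem_is_interval_1_I)
  qed
  \<comment> \<open>Hulls inside \<open>J v\<close> create no new intersection, and the selected
    points keep every old one.\<close>
  have "f ` J u \<inter> f ` J v \<noteq> {} \<longleftrightarrow> f ` {l u..r u} \<inter> f ` {l v..r v} \<noteq> {}"
    if uv: "u \<in> V" "v \<in> V" for u v
  proof
    assume "f ` J u \<inter> f ` J v \<noteq> {}"
    then obtain x y where "meet u v x y" by (auto simp: meet_def)
    then have m: "meet u v (a u v) (b u v)" by (rule ab)
    then have "a u v \<in> Q u" "b u v \<in> Q v" using uv by (auto simp: Q_def meet_def)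
    then show "f ` {l u..r u} \<inter> f ` {l v..r v} \<noteq> {}"
      using m in_hull unfolding meet_def by (metis disjoint_iff imageI)
  next
    assume "f ` {l u..r u} \<inter> f ` {l v..r v} \<noteq> {}"
    then show "f ` J u \<inter> f ` J v \<noteq> {}" using hull uv by blast
  qed
  then have "intersection_representation V E (\<lambda>v. f ` {l v..r v})"
    using rep by (simp add: intersection_representation_def)
  moreover have "\<forall>v\<in>V. l v \<le> r v" using in_hull self by fastforce
  ultimately show ?thesis by blast
qed

text \<open>If \<open>x\<close> lies to the right of the first interval, the overlap puts it to the
  right of the start of the second, and the induction moves on.\<close>

lemma overlapping_intervals_cover:
  fixes l r :: "'a \<Rightarrow> real"
  assumes "q \<noteq> []" "successively (\<lambda>u v. l v \<le> r u) q" "l (hd q) \<le> x" "x \<le> r (last q)"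
  shows "\<exists>y\<in>set q. l y \<le> x \<and> x \<le> r y"
  using assms
proof (induction q rule: induct_list012)
  case (3 y z zs)
  then show ?case by (cases "x \<le> r y") auto
qed auto

lemma (in connected_min_degree_2) interval_bounds:
  assumes "interval_graph V E"
  shows "graph_diam V E \<le> rainbow_connection_number V E \<and>
    rainbow_connection_number V E \<le> graph_diam V E + 1"
proof -
  obtain S :: "'a \<Rightarrow> real set" where S: "\<forall>v\<in>V. is_interval (S v) \<and> S v \<noteq> {}"
    "intersection_representation V E (\<lambda>v. id ` S v)"
    using assms by (auto simp: interval_graph_def)
  have "\<exists>l r :: 'a \<Rightarrow> real. (\<forall>v\<in>V. l v \<le> r v) \<and> intersection_representation V E (\<lambda>v. id ` {l v..r v})"
    by (rule closed_representation[where J = S]) (use S finite_V in auto)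
  then obtain l r :: "'a \<Rightarrow> real" where lr: "\<And>v. v \<in> V \<Longrightarrow> l v \<le> r v"
    and rep: "intersection_representation V E (\<lambda>v. id ` {l v..r v})"
    by auto
  have adj: "{u, v} \<in> E \<longleftrightarrow> l u \<le> r v \<and> l v \<le> r u" if uv: "u \<in> V" "v \<in> V" "u \<noteq> v" for u v
  proof -
    have "{l u..r u} \<inter> {l v..r v} \<noteq> {} \<longleftrightarrow> l u \<le> r v \<and> l v \<le> r u"
      using lr[OF uv(1)] lr[OF uv(2)] by auto
    then show ?thesis using rep uv by (simp add: intersection_representation_def)
  qed
  obtain u where u: "u \<in> V" and ru: "\<And>w. w \<in> V \<Longrightarrow> r u \<le> r w"
    using ex_maximum[of "\<lambda>w. - r w"] by auto
  obtain v where v: "v \<in> V" and lv: "\<And>w. w \<in> V \<Longrightarrow> l w \<le> l v"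
    using ex_maximum[of l] by blast
  show ?thesis
  proof (cases "l v \<le> r u")
    case True
    \<comment> \<open>Every interval contains the stretch from \<open>l v\<close> to
      \<open>r u\<close>, so the graph is complete.\<close>
    have "{x, y} \<in> E" if "x \<in> V" "y \<in> V" "x \<noteq> y" for x y
      using that adj[OF that] True ru lv by (meson order_trans)
    then show ?thesis using complete_bounds by fastforce
  next
    case False
    then have "u \<noteq> v" using lr u by force
    then have "{u, v} \<notin> E" using adj u v False by blast
    obtain p where p: "path_between V E u v p" "length p - 1 = graph_dist V E u v"
      using graph_dist_path conn u v unfolding connected_graph_def by metis
    obtain p' where p': "p = u # p'" using p(1) by (cases p) (auto simp: path_between_def)
    have "p' \<noteq> []" using p(1) \<open>u \<noteq> v\<close> by (auto simp: p' path_between_def)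
    then obtain q where q: "p' = q @ [v]"
      using p(1) by (cases p' rule: rev_cases) (auto simp: p' path_between_def)
    have "q \<noteq> []" using p(1) \<open>{u, v} \<notin> E\<close> by (auto simp: p' q path_between_def)
    have props: "set q \<subseteq> V" "distinct q" "successively (\<lambda>x y. {x, y} \<in> E) q"
      "{u, hd q} \<in> E" "{last q, v} \<in> E"
      using p(1) \<open>q \<noteq> []\<close>
      by (auto simp: p' q path_between_def successively_append_iff successively_Cons)
    have sub: "graph_dist V E u v \<le> graph_diam V E" by (rule graph_dist_le_diam[OF u v])
    have adj': "l y \<le> r x" if "{x, y} \<in> E" for x y
      using that adj edgeD[OF that] by blast
    show ?thesis
    proof (rule dominating_path_bounds[of "hd q" "last q" q])
      show "path_between V E (hd q) (last q) q" using props \<open>q \<noteq> []\<close> by (simp add: path_between_def)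
      \<comment> \<open>Dropping both ends of \<open>p\<close> leaves two edges fewer than the
        distance, and the three extra colours then exceed the distance by one.\<close>
      show "length q + 2 \<le> graph_diam V E + 1" using p(2) sub by (simp add: p' q)
      fix w assume w: "w \<in> V - set q"
      \<comment> \<open>This point lies in the interval of \<open>w\<close>, since no interval ends
        before \<open>r u\<close>, and within the range swept by \<open>q\<close>, since no interval
        starts after \<open>l v\<close>.\<close>
      let ?x = "max (l w) (r u)"
      have "\<exists>y\<in>set q. l y \<le> ?x \<and> ?x \<le> r y"
      proof (rule overlapping_intervals_cover[OF \<open>q \<noteq> []\<close>])
        show "successively (\<lambda>u v. l v \<le> r u) q"
          using props(3) by (rule successively_mono) (use adj' in auto)
        show "l (hd q) \<le> ?x" using adj'[OF props(4)] by simp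
        have "l v \<le> r (last q)" using adj'[OF props(5)] by simp
        then show "?x \<le> r (last q)" using False lv[of w] w by auto
      qed
      then obtain y where y: "y \<in> set q" "l y \<le> ?x" "?x \<le> r y" by blast
      moreover have "?x \<le> r w" using w lr ru by auto
      ultimately show "\<exists>d\<in>set q. {w, d} \<in> E" using adj[of w y] w props(1) by fastforce
    qed
  qed
qed

subsection \<open>AT-free graphs\<close>

context connected_min_degree_2
begin

text \<open>The vertices of the graph without the closed neighbourhood of \<open>z\<close>;
  \<open>joined_missing z\<close> is then the relation of lying in one component of that
  graph.\<close>

definition non_neighbours :: "'a \<Rightarrow> 'a set" where
  "non_neighbours z = {a \<in> V. a \<noteq> z \<and> {a, z} \<notin> E}"

abbreviation joined_missing :: "'a \<Rightarrow> 'a \<Rightarrow> 'a \<Rightarrow> bool" where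
  "joined_missing z \<equiv> joined E (non_neighbours z)"

lemma non_neighbours_sym: "a \<in> V \<Longrightarrow> b \<in> V \<Longrightarrow> a \<in> non_neighbours b \<longleftrightarrow> b \<in> non_neighbours a"
  by (auto simp: non_neighbours_def insert_commute)

lemma joined_missing_imp_path:
  assumes "joined_missing z u v" shows "path_avoiding_neighbours V E u v z"
proof -
  obtain p where "path_between (non_neighbours z) E u v p"
    using assms by (auto simp: joined_iff_path)
  then show ?thesis unfolding path_avoiding_neighbours_def path_between_def
    by (intro exI[of _ p]) (auto simp: non_neighbours_def neighbours_def insert_commute)
qed

text \<open>Membership in the sets \<open>non_neighbours\<close> already makes the triple distinct
  and independent, and the three connections are its avoiding paths.\<close>

lemma AT_free_cases:
  assumes "AT_free V E" "joined_missing v u x" "joined_missing u v x" "joined_missing x u v"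
  shows False
proof -
  have "u \<in> non_neighbours v" "x \<in> non_neighbours v" "x \<in> non_neighbours u" "v \<in> non_neighbours u"
    using joined_in assms(2,3) by metis+
  then have "asteroidal_triple V E u v x"
    using assms(2,3) assms(4) joined_missing_imp_path
    by (auto simp: asteroidal_triple_def non_neighbours_def insert_commute)
  then show False using assms(1) by (auto simp: AT_free_def)
qed

text \<open>Call \<open>u\<close>, \<open>v\<close> unrelated for \<open>x\<close> if each is joined to \<open>x\<close> by a path missing the other.
  The vertex maximising \<open>\<Phi>\<close> has no unrelated pair: otherwise, with the component of \<open>v\<close> in the
  graph missing \<open>x\<close> at most as large as the one of \<open>u\<close>, passing from \<open>x\<close> to \<open>v\<close> loses only the
  component of \<open>v\<close>, whereas the component of \<open>u\<close> gains the vertex \<open>x\<close>.\<close>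

lemma AT_free_pokable:
  assumes AT: "AT_free V E"
  shows "\<exists>x\<in>V. \<forall>u v. \<not> (joined_missing v u x \<and> joined_missing u v x)"
proof -
  define comp where "comp x w = {y. joined_missing x w y}" for x w
  \<comment> \<open>With base \<open>card V + 1\<close>, one exponent raised by one outweighs up to
    \<open>card V\<close> lost terms of the old exponent.\<close>
  define B where "B = Suc (card V)"
  define \<Phi> where "\<Phi> x = (\<Sum>w\<in>non_neighbours x. B ^ card (comp x w))" for x
  have nn: "non_neighbours x \<subseteq> V" for x by (auto simp: non_neighbours_def)
  have finn: "finite (non_neighbours x)" for x using nn finite_V finite_subset by blast
  have comp_sub: "comp x w \<subseteq> non_neighbours x" for x w using joined_in by (fastforce simp: comp_def)
  have fincomp: "finite (comp x w)" for x w using comp_sub finn finite_subset by blast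
  have B: "1 \<le> B" by (simp add: B_def)
  have better: "\<Phi> x < \<Phi> v" if uv: "joined_missing v u x" "joined_missing u v x"
      "card (comp x v) \<le> card (comp x u)" for x u v
  proof -
    have mem: "u \<in> non_neighbours v" "x \<in> non_neighbours v" "x \<in> non_neighbours u" "v \<in> non_neighbours u"
      using joined_in uv by metis+
    then have inV: "u \<in> V" "v \<in> V" "x \<in> V" using nn by blast+
    have mem': "u \<in> non_neighbours x" "v \<in> non_neighbours x" using mem non_neighbours_sym inV by blast+
    \<comment> \<open>Otherwise \<open>u\<close>, \<open>v\<close>, \<open>x\<close> would be
      asteroidal; so the component of \<open>u\<close> is not the one that is lost.\<close>
    have "\<not> joined_missing x u v" using AT_free_cases[OF AT] uv by blast
    then have "u \<notin> comp x v" by (auto simp: comp_def dest: joined_sym)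
    \<comment> \<open>A vertex equal or adjacent to \<open>v\<close> would lie in the component of
      \<open>v\<close>, so the other components survive when the closed neighbourhood of
      \<open>v\<close> is deleted instead.\<close>
    have comp_mono: "comp x w \<subseteq> comp v w" if w: "w \<in> non_neighbours x - comp x v" for w
    proof
      fix y assume "y \<in> comp x w"
      then obtain p where p: "walk_between (non_neighbours x) E w y p" by (auto simp: comp_def joined_def)
      have "set p \<subseteq> non_neighbours v"
      proof
        fix a assume a: "a \<in> set p"
        have wa: "joined_missing x w a" using walk_elem_joined[OF p a] .
        then have na: "\<not> joined_missing x v a"
          using w joined_trans[OF _ joined_sym[OF wa]] by (auto simp: comp_def)
        have ax: "a \<in> non_neighbours x" using joined_in[OF wa] by blast
        have "a \<noteq> v" using na joined_refl[OF mem'(2)] by blast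
        moreover have "{v, a} \<notin> E" using na joined_edge[OF mem'(2) ax] by blast
        moreover have "a \<in> V" using ax nn by blast
        ultimately show "a \<in> non_neighbours v" by (auto simp: non_neighbours_def insert_commute)
      qed
      then have "walk_between (non_neighbours v) E w y p" using p by (auto simp: walk_between_def)
      then show "y \<in> comp v w" by (auto simp: comp_def joined_def)
    qed
    let ?R = "non_neighbours x - comp x v - {u}"
    have u_in: "u \<in> non_neighbours x - comp x v" using mem' \<open>u \<notin> comp x v\<close> by blast
    have "x \<in> comp v u" "x \<notin> comp x u" using uv(1) comp_sub[of x u] by (auto simp: comp_def non_neighbours_def)
    then have "comp x u \<subset> comp v u" using comp_mono[OF u_in] by blast
    then have gain: "Suc (card (comp x u)) \<le> card (comp v u)" using psubset_card_mono fincomp by (metis Suc_leI)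
    \<comment> \<open>All vertices of the lost component carry the weight of \<open>v\<close>, which
      is at most that of \<open>u\<close>.\<close>
    have "(\<Sum>w\<in>comp x v. B ^ card (comp x w)) \<le> (\<Sum>w\<in>comp x v. B ^ card (comp x u))"
    proof (rule sum_mono)
      fix w assume "w \<in> comp x v"
      then have vw: "joined_missing x v w" by (simp add: comp_def)
      have "comp x w = comp x v"
        unfolding comp_def using joined_trans[OF vw] joined_trans[OF joined_sym[OF vw]] by blast
      then show "B ^ card (comp x w) \<le> B ^ card (comp x u)" using power_increasing[OF _ B] uv(3) by metis
    qed
    also have "\<dots> \<le> card V * B ^ card (comp x u)"
      using card_mono[OF finite_V, of "comp x v"] comp_sub[of x v] nn[of x] by auto
    finally have loss: "(\<Sum>w\<in>comp x v. B ^ card (comp x w)) \<le> card V * B ^ card (comp x u)" .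
    have "\<Phi> x = (\<Sum>w\<in>non_neighbours x - comp x v. B ^ card (comp x w)) + (\<Sum>w\<in>comp x v. B ^ card (comp x w))"
      unfolding \<Phi>_def by (rule sum.subset_diff[OF comp_sub finn])
    also have "(\<Sum>w\<in>non_neighbours x - comp x v. B ^ card (comp x w)) = B ^ card (comp x u) + (\<Sum>w\<in>?R. B ^ card (comp x w))"
      by (rule sum.remove) (use u_in finn in auto)
    finally have "\<Phi> x \<le> B ^ Suc (card (comp x u)) + (\<Sum>w\<in>?R. B ^ card (comp x w))"
      using loss by (simp add: B_def)
    also have "\<dots> \<le> B ^ card (comp v u) + (\<Sum>w\<in>?R. B ^ card (comp v w))"
    proof (rule add_mono)
      show "B ^ Suc (card (comp x u)) \<le> B ^ card (comp v u)" by (rule power_increasing[OF gain B])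
      show "(\<Sum>w\<in>?R. B ^ card (comp x w)) \<le> (\<Sum>w\<in>?R. B ^ card (comp v w))"
        by (intro sum_mono power_increasing[OF _ B] card_mono fincomp comp_mono) auto
    qed
    \<comment> \<open>Strictness comes from \<open>x\<close>, a new vertex whose term did not occur
      before.\<close>
    also have "\<dots> < B ^ card (comp v x) + (B ^ card (comp v u) + (\<Sum>w\<in>?R. B ^ card (comp v w)))"
      using B by simp
    also have "\<dots> = (\<Sum>w\<in>insert x (insert u ?R). B ^ card (comp v w))"
    proof -
      have fin: "finite ?R" "finite (insert u ?R)" using finn by simp_all
      have "u \<notin> ?R" by simp
      moreover have "x \<notin> insert u ?R" using mem(3) by (auto simp: non_neighbours_def)
      ultimately show ?thesis by (simp only: sum.insert fin if_False not_False_eq_True)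
    qed
    also have "\<dots> \<le> \<Phi> v" unfolding \<Phi>_def
    proof (rule sum_mono2[OF finn])
      have "w \<in> non_neighbours v" if w: "w \<in> non_neighbours x - comp x v" for w
      proof -
        have "w \<in> comp x w" using w joined_refl by (auto simp: comp_def)
        then show ?thesis using comp_mono[OF w] comp_sub[of v w] by blast
      qed
      then show "insert x (insert u ?R) \<subseteq> non_neighbours v" using mem by blast
    qed simp
    finally show ?thesis .
  qed
  obtain x where x: "x \<in> V" and max: "\<And>v. v \<in> V \<Longrightarrow> \<not> \<Phi> x < \<Phi> v"
    using ex_maximum[of \<Phi>] by (auto simp: not_less)
  have "\<not> (joined_missing v u x \<and> joined_missing u v x)" for u v
  proof
    assume uv: "joined_missing v u x \<and> joined_missing u v x"
    then have "u \<in> non_neighbours v" "v \<in> non_neighbours u" using joined_in by metis+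
    then have "u \<in> V" "v \<in> V" by (simp_all add: non_neighbours_def)
    \<comment> \<open>\<open>u\<close> and \<open>v\<close> play symmetric roles, so the one with
      the smaller component can be taken as the new vertex.\<close>
    then show False using better[of v u x] better[of u v x] uv max
      by (metis nat_le_linear)
  qed
  then show ?thesis using x by blast
qed

text \<open>Every path from \<open>y\<close> to \<open>x\<close> meets every closed neighbourhood.
  If that of \<open>z\<close> were missed by one, the choice of \<open>x\<close> would give
  \<open>dom y \<subset> dom z\<close>, against the maximality of \<open>y\<close>.\<close>

lemma AT_free_dominating_pair:
  assumes AT: "AT_free V E"
  shows "\<exists>x\<in>V. \<exists>y\<in>V. \<forall>z\<in>V. \<not> joined_missing z y x"
proof -
  obtain x where x: "x \<in> V" and pok: "\<And>u v. \<not> (joined_missing v u x \<and> joined_missing u v x)"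
    using AT_free_pokable[OF AT] by blast
  have nn: "non_neighbours x \<subseteq> V" for x by (auto simp: non_neighbours_def)
  define dom where "dom y = {z \<in> V. \<not> joined_missing z y x}" for y
  have fin: "finite (dom y)" for y using finite_V by (simp add: dom_def)
  obtain y where y: "y \<in> V" and max: "\<And>z. z \<in> V \<Longrightarrow> card (dom z) \<le> card (dom y)"
    using ex_maximum[of "\<lambda>y. card (dom y)"] by blast
  have False if z: "z \<in> V" and zyx: "joined_missing z y x" for z
  proof -
    have yz: "y \<in> non_neighbours z" using zyx joined_in by metis
    have "dom y \<subseteq> dom z"
    proof (rule ccontr)
      assume "\<not> dom y \<subseteq> dom z"
      then obtain w where w: "w \<in> V" "\<not> joined_missing w y x" "joined_missing w z x"
        by (auto simp: dom_def)
      obtain Q where Q: "walk_between (non_neighbours w) E z x Q" using w(3) by (auto simp: joined_def)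
      \<comment> \<open>A path from \<open>y\<close> to \<open>x\<close> misses \<open>z\<close>, so
        by the choice of \<open>x\<close> the walk \<open>Q\<close> must meet the closed
        neighbourhood of \<open>y\<close>.\<close>
      have "\<not> joined_missing y z x" using pok zyx by blast
      then have "\<not> set Q \<subseteq> non_neighbours y" using Q by (auto simp: joined_def walk_between_def)
      then obtain a where a: "a \<in> set Q" "a \<notin> non_neighbours y" by blast
      have za: "joined_missing w z a" using walk_elem_joined[OF Q a(1)] .
      then have aw: "a \<in> non_neighbours w" using joined_in by metis
      have ax: "joined_missing w a x" using za w(3) joined_sym joined_trans by metis
      have "a \<noteq> y" using ax w(2) by blast
      then have ya: "{y, a} \<in> E" using a(2) aw nn by (auto simp: non_neighbours_def insert_commute)
      \<comment> \<open>Otherwise going from \<open>y\<close> to \<open>a\<close> and on along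
        \<open>Q\<close> would miss \<open>w\<close>, contrary to \<open>w\<close> in
        \<open>dom y\<close>.\<close>
      have "y \<notin> non_neighbours w" using joined_edge[OF _ aw ya] joined_trans ax w(2) by metis
      moreover have "y \<noteq> w" using w(3) \<open>\<not> joined_missing y z x\<close> by blast
      ultimately have wy: "{w, y} \<in> E" using y by (auto simp: non_neighbours_def insert_commute)
      have "z \<in> non_neighbours w" using za joined_in by metis
      then have "w \<in> non_neighbours z" using non_neighbours_sym w(1) z by blast
      \<comment> \<open>From \<open>w\<close> via \<open>y\<close> to \<open>x\<close> one misses
        \<open>z\<close>, while \<open>Q\<close> misses \<open>w\<close>: an unrelated pair.\<close>
      then have "joined_missing z w x" using joined_edge[OF _ yz wy] joined_trans zyx by metis
      then show False using pok w(3) by blast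
    qed
    moreover have "z \<notin> dom y" using zyx by (simp add: dom_def)
    moreover have "z \<in> dom z"
      using z joined_in[of E "non_neighbours z" z x] by (auto simp: dom_def non_neighbours_def)
    ultimately have "dom y \<subset> dom z" by blast
    then have "card (dom y) < card (dom z)" by (rule psubset_card_mono[OF fin])
    then show False using max[OF z] by simp
  qed
  then show ?thesis using x y by blast
qed

lemma AT_free_bounds:
  assumes "AT_free V E"
  shows "graph_diam V E \<le> rainbow_connection_number V E \<and>
    rainbow_connection_number V E \<le> graph_diam V E + 3"
proof -
  obtain x y where xy: "x \<in> V" "y \<in> V" and dom: "\<And>z. z \<in> V \<Longrightarrow> \<not> joined_missing z y x"
    using AT_free_dominating_pair[OF assms] by blast
  obtain p where p: "path_between V E y x p" "length p - 1 = graph_dist V E y x"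
    using graph_dist_path conn xy unfolding connected_graph_def by metis
  show ?thesis
  proof (rule dominating_path_bounds[OF p(1)])
    show "length p + 2 \<le> graph_diam V E + 3" using p(2) graph_dist_le_diam[OF xy(2,1)] by linarith
    fix v assume v: "v \<in> V - set p"
    then have "\<not> walk_between (non_neighbours v) E y x p" using dom[of v] by (auto simp: joined_def)
    then have "\<not> set p \<subseteq> non_neighbours v" using p(1) by (auto simp: walk_between_def path_between_def)
    then show "\<exists>d\<in>set p. {v, d} \<in> E"
      using v p(1) by (auto simp: non_neighbours_def path_between_def insert_commute)
  qed
qed

end

subsection \<open>Dominating cycles and circular arc graphs\<close>

lemma path_edges_map_upt:
  "path_edges (map f [a..<Suc (a + n)]) = map (\<lambda>t. {f t, f (Suc t)}) [a..<a + n]"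
proof (induction n)
  case (Suc n)
  have "path_edges (map f [a..<Suc (a + Suc n)])
      = path_edges (map f [a..<a + n] @ f (a + n) # [f (Suc (a + n))])"
    by simp
  also have "\<dots> = path_edges (map f [a..<a + n] @ [f (a + n)]) @ path_edges (f (a + n) # [f (Suc (a + n))])"
    by (rule path_edges_append)
  also have "map f [a..<a + n] @ [f (a + n)] = map f [a..<Suc (a + n)]" by simp
  finally show ?case using Suc.IH by simp
qed simp

text \<open>Colours run through \<open>h\<close> values and then start again, with \<open>h\<close>
  half of \<open>k\<close> rounded up; of the two arcs between two vertices one repeats no
  colour.\<close>

lemma (in connected_min_degree_2) rainbow_dominating_cycle:
  fixes g :: "nat \<Rightarrow> 'a"
  assumes k: "2 \<le> k" and inj: "inj_on g {..<k}"
    and edges: "\<And>i. i < k \<Longrightarrow> {g i, g (Suc i mod k)} \<in> E"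
    and dom: "\<And>v. v \<in> V - g ` {..<k} \<Longrightarrow> \<exists>d\<in>g ` {..<k}. {v, d} \<in> E"
  shows "\<exists>c :: 'a set \<Rightarrow> nat. rainbow_connected V E c \<and> card (c ` E) \<le> Suc k div 2 + 3"
proof -
  define h where "h = Suc k div 2"
  have h: "1 \<le> h" "k \<le> 2 * h" "h < k" using k by (auto simp: h_def)
  define e where "e i = {g i, g (Suc i mod k)}" for i
  define col where "col i = (if i < h then i else i - h)" for i
  define c0 where "c0 x = (if x \<in> e ` {..<k} then col (inv_into {..<k} e x) else 0)" for x
  have col_less: "col i < h" if "i < k" for i using that h by (auto simp: col_def)
  have mod_k: "Suc i mod k < k" for i using k by simp
  have c0_e: "c0 (e i) = col i" if i: "i < k" for i
  proof -
    define j where "j = inv_into {..<k} e (e i)"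
    have ei: "e i \<in> e ` {..<k}" using i by blast
    then have j: "j < k" "e j = e i" using inv_into_into[OF ei] f_inv_into_f[OF ei] by (auto simp: j_def)
    have "col j = col i"
    \<comment> \<open>For \<open>k = 2\<close> the cycle is one edge traversed twice, and
      \<open>h = 1\<close> gives both positions the same colour. For larger \<open>k\<close> the map
      \<open>e\<close> is injective.\<close>
    proof (cases "k = 2")
      case True
      then have "h = 1" by (simp add: h_def)
      then show ?thesis using True i j(1) by (auto simp: col_def)
    next
      case False
      have g_eq: "x = y" if "g x = g y" "x < k" "y < k" for x y using inj that by (auto dest: inj_onD)
      from j(2) consider "g j = g i" | "g j = g (Suc i mod k)" "g (Suc j mod k) = g i"
        unfolding e_def doubleton_eq_iff by blast
      then have "j = i"
      proof cases
        case 1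
        then show ?thesis using g_eq i j by blast
      next
        case 2
        then have "j = Suc i mod k" "i = Suc j mod k" using g_eq i j mod_k by metis+
        then show ?thesis using i j(1) k False by (auto simp: mod_Suc split: if_splits)
      qed
      then show ?thesis by simp
    qed
    then show ?thesis using ei by (simp add: c0_def j_def)
  qed
  let ?D = "g ` {..<k}"
  have arc: "rainbow_joined ?D E c0 (g (a mod k)) (g ((a + n) mod k))"
    if inj_col: "inj_on (\<lambda>t. col (t mod k)) {a..<a + n}" for a n
  proof -
    let ?p = "map (\<lambda>t. g (t mod k)) [a..<Suc (a + n)]"
    have "successively (\<lambda>x y. {x, y} \<in> E) ?p"
      unfolding successively_map successively_conv_nth
      using edges[of "t mod k" for t] k by (auto simp: mod_Suc_eq nth_append simp del: upt_Suc)
    moreover have "hd ?p = g (a mod k)" "last ?p = g ((a + n) mod k)"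
      by (simp add: upt_conv_Cons del: upt_Suc) simp
    moreover have "set ?p \<subseteq> ?D" using k by auto
    ultimately have walk: "walk_between ?D E (g (a mod k)) (g ((a + n) mod k)) ?p"
      by (simp add: walk_between_def)
    have "path_edges ?p = map (\<lambda>t. e (t mod k)) [a..<a + n]"
      unfolding path_edges_map_upt by (simp add: e_def mod_Suc_eq)
    then have "map c0 (path_edges ?p) = map (\<lambda>t. col (t mod k)) [a..<a + n]"
      using c0_e k by simp
    then have "distinct (map c0 (path_edges ?p))" using inj_col by (simp add: distinct_map)
    then show ?thesis using walk unfolding rainbow_joined_def by blast
  qed
  have ordered: "rainbow_joined ?D E c0 (g i) (g j)" if ij: "i \<le> j" "j < k" for i j
  proof (cases "j - i \<le> h")
    case True
    have "inj_on (\<lambda>t. col (t mod k)) {i..<i + (j - i)}"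
      by (rule inj_onI) (use True ij in \<open>auto simp: col_def split: if_splits\<close>)
    from arc[OF this] show ?thesis using ij by simp
  next
    case False
    \<comment> \<open>On the other arc the colours before the wrap are at least
      \<open>j - h\<close>, those after it lie below \<open>i\<close>, and
      \<open>i < j - h\<close>.\<close>
    have "inj_on (\<lambda>t. col (t mod k)) {j..<j + (k - j + i)}"
    proof (rule inj_onI)
      fix s t assume st: "s \<in> {j..<j + (k - j + i)}" "t \<in> {j..<j + (k - j + i)}"
        and eq: "col (s mod k) = col (t mod k)"
      have md: "x mod k = (if x < k then x else x - k)" if "x \<in> {j..<j + (k - j + i)}" for x
        using that ij by (auto simp: mod_if)
      show "s = t" using eq st False ij h unfolding md[OF st(1)] md[OF st(2)] col_def
        by (auto split: if_splits)
    qed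
    from arc[OF this] have "rainbow_joined ?D E c0 (g j) (g i)" using ij by simp
    then show ?thesis by (rule rainbow_joined_sym)
  qed
  have "\<exists>c :: 'a set \<Rightarrow> nat. rainbow_connected V E c \<and> card (c ` E) \<le> h + 3"
  proof (rule rainbow_three_extra_colours[of ?D c0])
    show "?D \<subseteq> V" using edges edgeD(1) by blast
    show "\<exists>d\<in>?D. {v, d} \<in> E" if "v \<in> V - ?D" for v using dom that by blast
    show "c0 x < h" for x
    proof (cases "x \<in> e ` {..<k}")
      case True
      then show ?thesis using c0_e col_less by auto
    qed (use h in \<open>simp add: c0_def\<close>)
    fix u v assume "u \<in> ?D" "v \<in> ?D"
    then obtain i j where "u = g i" "v = g j" "i < k" "j < k" by blast
    then show "rainbow_joined ?D E c0 u v"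
      using ordered[of i j] ordered[of j i] rainbow_joined_sym nat_le_linear by metis
  qed
  then show ?thesis by (simp add: h_def)
qed

section \<open>Circular arcs lifted to the line\<close>

lemma circular_arc_closed:
  assumes "finite V" "circular_arc_graph V E"
  shows "\<exists>l r :: 'a \<Rightarrow> real. (\<forall>v\<in>V. l v \<le> r v) \<and> (\<forall>u\<in>V. \<forall>v\<in>V. u \<noteq> v \<longrightarrow>
    ({u, v} \<in> E \<longleftrightarrow> (\<exists>k :: int. l u \<le> r v + 2 * pi * k \<and> l v + 2 * pi * k \<le> r u)))"
proof -
  obtain S :: "'a \<Rightarrow> complex set" where S: "\<forall>v\<in>V. circle_arc (S v)" "intersection_representation V E S"
    using assms(2) by (auto simp: circular_arc_graph_def)
  obtain J where J: "\<forall>v\<in>V. is_interval (J v) \<and> J v \<noteq> {} \<and> S v = cis ` J v"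
    using bchoice[OF S(1)[unfolded circle_arc_def]] by blast
  have "intersection_representation V E (\<lambda>v. cis ` J v)"
    using S(2) J by (simp add: intersection_representation_def)
  then have "\<exists>l r :: 'a \<Rightarrow> real. (\<forall>v\<in>V. l v \<le> r v) \<and>
      intersection_representation V E (\<lambda>v. cis ` {l v..r v})"
    by (intro closed_representation[where J = J]) (use assms(1) J in auto)
  then obtain l r :: "'a \<Rightarrow> real" where lr: "\<forall>v\<in>V. l v \<le> r v"
    and rep: "intersection_representation V E (\<lambda>v. cis ` {l v..r v})"
    by auto
  have cis_eq: "cis a = cis b \<longleftrightarrow> (\<exists>k :: int. a = b + 2 * pi * k)" for a b
    using sin_cos_eq_iff[of a b] by (simp add: complex_eq_iff conj_commute)
  have "cis ` {l u..r u} \<inter> cis ` {l v..r v} \<noteq> {} \<longleftrightarrow>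
      (\<exists>k :: int. l u \<le> r v + 2 * pi * k \<and> l v + 2 * pi * k \<le> r u)" if uv: "u \<in> V" "v \<in> V" for u v
  proof
    assume "cis ` {l u..r u} \<inter> cis ` {l v..r v} \<noteq> {}"
    then obtain a b where ab: "a \<in> {l u..r u}" "b \<in> {l v..r v}" "cis a = cis b" by fastforce
    then obtain k :: int where "a = b + 2 * pi * k" using cis_eq by blast
    then show "\<exists>k :: int. l u \<le> r v + 2 * pi * k \<and> l v + 2 * pi * k \<le> r u"
      using ab by (intro exI[of _ k]) auto
  next
    assume "\<exists>k :: int. l u \<le> r v + 2 * pi * k \<and> l v + 2 * pi * k \<le> r u"
    then obtain k :: int where k: "l u \<le> r v + 2 * pi * k" "l v + 2 * pi * k \<le> r u" by blast
    define a where "a = max (l u) (l v + 2 * pi * k)"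
    define b where "b = a - 2 * pi * k"
    have "a \<in> {l u..r u}" "b \<in> {l v..r v}" using k lr uv by (auto simp: a_def b_def max_def)
    moreover have "cis a = cis b" unfolding cis_eq by (rule exI[of _ k]) (simp add: b_def)
    ultimately show "cis ` {l u..r u} \<inter> cis ` {l v..r v} \<noteq> {}" by (metis IntI empty_iff imageI)
  qed
  then show ?thesis
    using lr rep by (intro exI[of _ l] exI[of _ r]) (simp add: intersection_representation_def)
qed

text \<open>The arcs are lifted to the universal cover: \<open>(v, k)\<close> stands for the \<open>k\<close>-th translate of the
  interval of \<open>v\<close> on the line, the circle having circumference \<open>T\<close>.\<close>

locale circular_arcs = connected_min_degree_2 V E for V :: "'a set" and E +
  fixes l r :: "'a \<Rightarrow> real" and T :: real
  assumes T: "0 < T" and lr: "\<And>v. v \<in> V \<Longrightarrow> l v \<le> r v"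
    and adj: "\<And>u v. \<lbrakk>u \<in> V; v \<in> V; u \<noteq> v\<rbrakk> \<Longrightarrow>
      {u, v} \<in> E \<longleftrightarrow> (\<exists>k :: int. l u \<le> r v + T * k \<and> l v + T * k \<le> r u)"
begin

definition L :: "'a \<times> int \<Rightarrow> real" where "L x = l (fst x) + T * of_int (snd x)"
definition R :: "'a \<times> int \<Rightarrow> real" where "R x = r (fst x) + T * of_int (snd x)"

lemma L_le_R: "fst x \<in> V \<Longrightarrow> L x \<le> R x"
  using lr by (simp add: L_def R_def)

lemma shift_mono: "i \<le> j \<Longrightarrow> T * of_int i \<le> T * of_int j"
  using T by simp

lemma lifted_adj:
  assumes "fst x \<in> V" "fst y \<in> V" "fst x \<noteq> fst y" "L x \<le> R y" "L y \<le> R x"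
  shows "{fst x, fst y} \<in> E"
  unfolding adj[OF assms(1-3)]
  by (rule exI[of _ "snd y - snd x"]) (use assms(4,5) in \<open>simp add: L_def R_def algebra_simps\<close>)

lemma adj_lift:
  assumes "{u, v} \<in> E"
  shows "\<exists>k. \<forall>a. L (u, a) \<le> R (v, a + k) \<and> L (v, a + k) \<le> R (u, a)"
proof -
  obtain k :: int where "l u \<le> r v + T * k" "l v + T * k \<le> r u"
    using assms adj edgeD[OF assms] by blast
  then show ?thesis by (intro exI[of _ k]) (simp add: L_def R_def algebra_simps)
qed

text \<open>Nothing crosses \<open>t\<close> to the right, so the line can be cut there and at its
  translates: each vertex has one lift inside the half-open window from \<open>t\<close> to
  \<open>t + T\<close>, which serves as its interval.\<close>

lemma cut_imp_interval_graph:
  assumes cut: "\<And>x. fst x \<in> V \<Longrightarrow> \<not> (L x \<le> t \<and> t < R x)"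
  shows "interval_graph V E"
proof -
  define m where "m v = \<lfloor>(t - l v) / T\<rfloor> + 1" for v
  have left: "t < L (v, m v)" "L (v, m v) \<le> t + T" for v
  proof -
    have "(t - l v) / T < m v" "m v \<le> (t - l v) / T + 1" unfolding m_def by linarith+
    then show "t < L (v, m v)" "L (v, m v) \<le> t + T"
      using T by (auto simp: L_def field_simps)
  qed
  \<comment> \<open>The previous translate starts at or before \<open>t\<close>, so by the cut it
    ends by \<open>t\<close>.\<close>
  have right: "R (v, m v) \<le> t + T" if "v \<in> V" for v
    using cut[of "(v, m v - 1)"] left[of v] that by (auto simp: L_def R_def algebra_simps)
  define S where "S v = {L (v, m v)..R (v, m v)}" for v
  have ends: "L (v, m v) \<le> R (v, m v)" if "v \<in> V" for v using L_le_R that by simp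
  have "{u, v} \<in> E \<longleftrightarrow> S u \<inter> S v \<noteq> {}" if uv: "u \<in> V" "v \<in> V" "u \<noteq> v" for u v
  proof -
    have "S u \<inter> S v \<noteq> {} \<longleftrightarrow> L (u, m u) \<le> R (v, m v) \<and> L (v, m v) \<le> R (u, m u)"
      using ends[OF uv(1)] ends[OF uv(2)] by (auto simp: S_def)
    also have "\<dots> \<longleftrightarrow> {u, v} \<in> E"
    proof
      assume "{u, v} \<in> E"
      then obtain k where k: "L (u, m u) \<le> R (v, m u + k)" "L (v, m u + k) \<le> R (u, m u)"
        using adj_lift by blast
      \<comment> \<open>Otherwise the two lifts would lie in different, hence disjoint,
        windows.\<close>
      have "m u + k = m v"
      proof (rule ccontr)
        assume "m u + k \<noteq> m v"
        then consider "m v + 1 \<le> m u + k" | "m u + k \<le> m v - 1" by linarith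
        then show False
        proof cases
          case 1
          then show False using shift_mono[OF 1] k(2) left[of v] right[OF uv(1)]
            by (simp add: L_def R_def algebra_simps)
        next
          case 2
          then show False using shift_mono[OF 2] k(1) left[of u] right[OF uv(2)]
            by (simp add: L_def R_def algebra_simps)
        qed
      qed
      then show "L (u, m u) \<le> R (v, m v) \<and> L (v, m v) \<le> R (u, m u)" using k by simp
    next
      assume "L (u, m u) \<le> R (v, m v) \<and> L (v, m v) \<le> R (u, m u)"
      then show "{u, v} \<in> E" using lifted_adj[of "(u, m u)" "(v, m v)"] uv by simp
    qed
    finally show ?thesis by blast
  qed
  then show ?thesis unfolding interval_graph_def intersection_representation_def
    by (intro exI[of _ S]) (use ends in \<open>auto simp: S_def is_interval_cc\<close>)
qed

text \<open>Only finitely many lifts contain \<open>t\<close> and extend beyond it, so one of them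
  reaches furthest; lifts ending by \<open>t\<close> cannot beat it.\<close>

lemma greedy_step:
  assumes cover: "\<exists>x. fst x \<in> V \<and> L x \<le> t \<and> t < R x"
  shows "\<exists>y. fst y \<in> V \<and> L y \<le> t \<and> t < R y \<and> (\<forall>z. fst z \<in> V \<and> L z \<le> t \<longrightarrow> R z \<le> R y)"
proof -
  define M where "M = {x. fst x \<in> V \<and> L x \<le> t \<and> t < R x}"
  have "M \<subseteq> (SIGMA v:V. {\<lfloor>(t - r v) / T\<rfloor>..\<lfloor>(t - l v) / T\<rfloor>})"
  proof
    fix x assume x: "x \<in> M"
    then have "of_int (snd x) \<le> (t - l (fst x)) / T" "(t - r (fst x)) / T < of_int (snd x)"
      using T by (auto simp: M_def L_def R_def field_simps)
    then show "x \<in> (SIGMA v:V. {\<lfloor>(t - r v) / T\<rfloor>..\<lfloor>(t - l v) / T\<rfloor>})"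
      using x by (cases x) (auto simp: M_def le_floor_iff floor_le_iff)
  qed
  then have fin: "finite M" using finite_V finite_subset by fastforce
  have "M \<noteq> {}" using cover by (auto simp: M_def)
  then have "Max (R ` M) \<in> R ` M" using fin by simp
  then obtain y where y: "y \<in> M" "R y = Max (R ` M)" by (metis imageE)
  have "R z \<le> R y" if "fst z \<in> V" "L z \<le> t" for z
  proof (cases "t < R z")
    case True
    then have "z \<in> M" using that by (simp add: M_def)
    then show ?thesis using fin y by simp
  next
    case False
    then show ?thesis using y(1) by (auto simp: M_def)
  qed
  then show ?thesis using y(1) unfolding M_def by blast
qed

text \<open>A lift overlapping one that ends by \<open>t i\<close> starts by \<open>t i\<close> and
  so ends by \<open>t (Suc i)\<close>: an edge gains at most one greedy step. \<open>s\<close> is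
  the translation accumulated along \<open>p\<close>; the second half is the same for the reversed
  walk.\<close>

lemma walk_reach:
  assumes step: "\<And>i z. \<lbrakk>fst z \<in> V; L z \<le> t i\<rbrakk> \<Longrightarrow> R z \<le> t (Suc i)"
    and "p \<noteq> []" "successively (\<lambda>x y. {x, y} \<in> E) p"
  shows "\<exists>s. \<forall>a i. (R (hd p, a) \<le> t i \<longrightarrow> R (last p, a + s) \<le> t (i + (length p - 1))) \<and>
    (R (last p, a + s) \<le> t i \<longrightarrow> R (hd p, a) \<le> t (i + (length p - 1)))"
  using assms(2,3)
proof (induction p rule: induct_list012)
  case (2 x)
  then show ?case by (intro exI[of _ 0]) simp
next
  case (3 x y zs)
  then have "\<exists>s. \<forall>a i. (R (y, a) \<le> t i \<longrightarrow> R (last (y # zs), a + s) \<le> t (i + length zs)) \<and>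
      (R (last (y # zs), a + s) \<le> t i \<longrightarrow> R (y, a) \<le> t (i + length zs))"
    by simp
  then obtain s where s: "\<forall>a i. (R (y, a) \<le> t i \<longrightarrow> R (last (y # zs), a + s) \<le> t (i + length zs)) \<and>
      (R (last (y # zs), a + s) \<le> t i \<longrightarrow> R (y, a) \<le> t (i + length zs))"
    by (rule exE)
  have xy: "{x, y} \<in> E" using 3 by simp
  obtain k where k: "\<And>a. L (x, a) \<le> R (y, a + k)" "\<And>a. L (y, a + k) \<le> R (x, a)"
    using adj_lift[OF xy] by blast
  show ?case
  proof (rule exI[of _ "k + s"], intro allI conjI impI)
    fix a i
    assume "R (hd (x # y # zs), a) \<le> t i"
    then have "R (y, a + k) \<le> t (Suc i)" using k(2)[of a] edgeD[OF xy] step[of "(y, a + k)" i] by simp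
    then have "R (last (y # zs), a + k + s) \<le> t (Suc i + length zs)" using s by blast
    then show "R (last (x # y # zs), a + (k + s)) \<le> t (i + (length (x # y # zs) - 1))"
      by (simp add: add.assoc)
  next
    fix a i
    assume "R (last (x # y # zs), a + (k + s)) \<le> t i"
    then have "R (last (y # zs), a + k + s) \<le> t i" by (simp add: add.assoc)
    then have "R (y, a + k) \<le> t (i + length zs)" using s by blast
    then show "R (hd (x # y # zs), a) \<le> t (i + (length (x # y # zs) - 1))"
      using k(1)[of a] edgeD[OF xy] step[of "(x, a)" "i + length zs"] by simp
  qed
qed simp

lemma bounds:
  "graph_diam V E \<le> rainbow_connection_number V E \<and>
    rainbow_connection_number V E \<le> graph_diam V E + 4"
proof (cases "\<exists>t. \<forall>x. fst x \<in> V \<longrightarrow> \<not> (L x \<le> t \<and> t < R x)")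
  case True
  then have "interval_graph V E" using cut_imp_interval_graph by blast
  then show ?thesis using interval_bounds by linarith
next
  case False
  then have "\<forall>t. \<exists>y. fst y \<in> V \<and> L y \<le> t \<and> t < R y \<and> (\<forall>z. fst z \<in> V \<and> L z \<le> t \<longrightarrow> R z \<le> R y)"
    by (intro allI greedy_step) blast
  then obtain nxt where nxt: "\<And>t. fst (nxt t) \<in> V" "\<And>t. L (nxt t) \<le> t" "\<And>t. t < R (nxt t)"
    "\<And>t z. \<lbrakk>fst z \<in> V; L z \<le> t\<rbrakk> \<Longrightarrow> R z \<le> R (nxt t)"
    by metis
  \<comment> \<open>Starting from a longest arc excludes that the second arc extends the first on
    both sides; \<open>distinct\<close> relies on this.\<close>
  obtain v0 where v0: "v0 \<in> V" and longest: "\<And>v. v \<in> V \<Longrightarrow> r v - l v \<le> r v0 - l v0"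
    using ex_maximum[of "\<lambda>v. r v - l v"] by blast
  define g where "g n = ((\<lambda>x. nxt (R x)) ^^ n) (v0, 0)" for n :: nat
  define t where "t n = R (g n)" for n
  have g0: "g 0 = (v0, 0)" and gS: "g (Suc n) = nxt (t n)" for n by (simp_all add: g_def t_def)
  have gV: "fst (g n) \<in> V" for n using g0 gS nxt(1) v0 by (cases n) simp_all
  have step: "R z \<le> t (Suc i)" if "fst z \<in> V" "L z \<le> t i" for z i
    using nxt(4)[OF that] by (simp add: t_def[of "Suc i"] gS)
  have Lg: "L (g (Suc n)) \<le> t n" for n using nxt(2) by (simp add: gS)
  have mono: "strict_mono t"
    unfolding strict_mono_Suc_iff using nxt(3) by (simp add: t_def[of "Suc _"] gS)
  \<comment> \<open>Right ends increase along the sequence, so a vertex that recurs does so at least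
    one full turn later.\<close>
  have again: "L (g i) + T \<le> L (g j)" "R (g i) + T \<le> R (g j)"
    if ij: "i < j" "fst (g i) = fst (g j)" for i j
  proof -
    have "t i < t j" using mono ij(1) by (simp add: strict_mono_less)
    then have "T * of_int (snd (g i)) < T * of_int (snd (g j))" using ij(2) by (simp add: t_def R_def)
    then have "snd (g i) + 1 \<le> snd (g j)" using T by simp
    from shift_mono[OF this] show "L (g i) + T \<le> L (g j)" "R (g i) + T \<le> R (g j)"
      using ij(2) by (simp_all add: L_def R_def algebra_simps)
  qed
  have "\<exists>n. L (g 0) + T \<le> t n"
  proof -
    have "finite (range (\<lambda>n. fst (g n)))" by (rule finite_subset[OF _ finite_V]) (use gV in auto)
    then have "\<not> inj (\<lambda>n. fst (g n))" using finite_imageD infinite_UNIV_nat by blast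
    then obtain i j where "i \<noteq> j" "fst (g i) = fst (g j)" unfolding inj_def by blast
    then obtain i j where ij: "i < j" "fst (g i) = fst (g j)" using that by (metis linorder_neqE_nat)
    have "L (g 0) \<le> R (g 0)" using L_le_R gV by blast
    also have "\<dots> \<le> R (g i)" using strict_mono_less_eq[OF mono, of 0 i] by (simp add: t_def)
    finally show ?thesis using again(2)[OF ij] by (intro exI[of _ j]) (simp add: t_def)
  qed
  define m where "m = (LEAST n. L (g 0) + T \<le> t n)"
  have m: "L (g 0) + T \<le> t m" unfolding m_def by (rule LeastI_ex) fact
  have m_least: "m \<le> n" if "L (g 0) + T \<le> t n" for n
    unfolding m_def by (rule Least_le) (rule that)
  \<comment> \<open>Take the lift of \<open>v\<close> that starts within the first turn: the first
    \<open>g n\<close> reaching that start also contains it.\<close>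
  have dom: "\<exists>n\<le>m. v \<noteq> fst (g n) \<longrightarrow> {v, fst (g n)} \<in> E" if v: "v \<in> V" for v
  proof -
    define a where "a = \<lceil>(l v0 - l v) / T\<rceil>"
    have "(l v0 - l v) / T \<le> a" "a < (l v0 - l v) / T + 1" unfolding a_def by linarith+
    then have a: "L (g 0) \<le> L (v, a)" "L (v, a) < L (g 0) + T"
      using T by (auto simp: L_def g0 field_simps)
    define n where "n = (LEAST n. L (v, a) \<le> t n)"
    have "L (v, a) \<le> t m" using a(2) m by linarith
    then have n: "L (v, a) \<le> t n" "n \<le> m" unfolding n_def by (rule LeastI, rule Least_le)
    have "L (g n) \<le> L (v, a)"
    proof (cases n)
      case 0
      then show ?thesis using a(1) by simp
    next
      case (Suc n')
      then have "\<not> L (v, a) \<le> t n'" unfolding n_def by (metis lessI not_less_Least)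
      then show ?thesis using Lg[of n'] Suc by simp
    qed
    then have "L (g n) \<le> R (v, a)" using L_le_R[of "(v, a)"] v by simp
    then show ?thesis using lifted_adj[of "(v, a)" "g n"] n v gV by (intro exI[of _ n]) (auto simp: t_def)
  qed
  show ?thesis
  proof (cases "m = 0")
    case True
    \<comment> \<open>Here the arc of \<open>v0\<close> alone already goes once around.\<close>
    show ?thesis
      by (rule universal_vertex_bounds[OF v0]) (use dom True g0 in auto)
  next
    case False
    define c where "c n = fst (g n)" for n
    have below: "L (g j) < L (g 0) + T" if "0 < j" "j \<le> m" for j
    proof -
      obtain j' where j': "j = Suc j'" using \<open>0 < j\<close> by (cases j) auto
      have "\<not> L (g 0) + T \<le> t j'" using m_least[of j'] that j' by auto
      then show ?thesis using Lg[of j'] j' by simp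
    qed
    \<comment> \<open>By \<open>again\<close> and \<open>below\<close>, a repetition would make
      \<open>g i\<close> start before \<open>g 0\<close>. For \<open>i = 1\<close> this contradicts
      the length of \<open>v0\<close>; for larger \<open>i\<close> the greedy rule would have
      reached as far one step earlier.\<close>
    have distinct: "c i \<noteq> c j" if "i < j" "j \<le> m" for i j
    proof
      assume "c i = c j"
      then have less: "L (g i) < L (g 0)" using again(1)[of i j] that below[of j] by (simp add: c_def)
      then obtain i' where i': "i = Suc i'" by (cases i) auto
      show False
      proof (cases i')
        case 0
        have "R (g 0) < R (g i)" using strict_monoD[OF mono, of 0 i] i' by (simp add: t_def)
        then show False using less longest[OF gV, of i] by (simp add: L_def R_def g0)
      next
        case (Suc i'')
        have "\<not> L (g i) \<le> t i''"
        proof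
          assume "L (g i) \<le> t i''"
          then have "t i \<le> t i'" using step[OF gV] Suc by (simp add: t_def[of i])
          then show False using strict_mono_less_eq[OF mono] i' by simp
        qed
        moreover have "L (g 0) \<le> t 0" using L_le_R gV by (simp add: t_def)
        moreover have "t 0 \<le> t i''" using strict_mono_less_eq[OF mono] by simp
        ultimately show False using less by linarith
      qed
    qed
    have "\<exists>f :: 'a set \<Rightarrow> nat. rainbow_connected V E f \<and> card (f ` E) \<le> Suc (Suc m) div 2 + 3"
    proof (rule rainbow_dominating_cycle[of "Suc m" c])
      show "2 \<le> Suc m" using False by simp
      show "inj_on c {..<Suc m}"
        by (rule linorder_inj_onI) (use distinct in auto)
      show "{c i, c (Suc i mod Suc m)} \<in> E" if "i < Suc m" for i
      proof (cases "i = m")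
        case True
        \<comment> \<open>The next lift of \<open>v0\<close> starts inside \<open>g m\<close>, which
          closes the cycle.\<close>
        have "L (g m) \<le> L (v0, 1)" "L (v0, 1) \<le> R (g m)"
          using below[of m] False m by (simp_all add: L_def g0 t_def)
        moreover have "L (v0, 1) \<le> R (v0, 1)" using L_le_R v0 by simp
        ultimately have "{fst (g m), fst (v0, 1 :: int)} \<in> E"
          using lifted_adj[of "g m" "(v0, 1)"] gV v0 distinct[of 0 m] False by (simp add: c_def g0)
        then show ?thesis using True by (simp add: c_def g0)
      next
        case False
        have "L (g i) \<le> R (g (Suc i))"
          using L_le_R[OF gV, of i] strict_monoD[OF mono, of i "Suc i"] by (simp add: t_def)
        then have "{c i, c (Suc i)} \<in> E"
          using lifted_adj[OF gV gV, of i "Suc i"] Lg[of i] distinct[of i "Suc i"] that False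
          by (simp add: c_def t_def)
        then show ?thesis using that False by simp
      qed
      fix v assume v: "v \<in> V - c ` {..<Suc m}"
      then obtain n where "n \<le> m" "v \<noteq> fst (g n) \<longrightarrow> {v, fst (g n)} \<in> E" using dom by blast
      then show "\<exists>d\<in>c ` {..<Suc m}. {v, d} \<in> E" using v by (auto simp: c_def)
    qed
    then obtain f :: "'a set \<Rightarrow> nat" where f: "rainbow_connected V E f" "card (f ` E) \<le> Suc (Suc m) div 2 + 3"
      by blast
    define j where "j = m div 2"
    obtain p where p: "path_between V E (c 0) (c j) p" "length p - 1 = graph_dist V E (c 0) (c j)"
      using graph_dist_path conn gV unfolding connected_graph_def c_def by metis
    define n where "n = length p - 1"
    obtain s where s: "\<And>a i. R (c 0, a) \<le> t i \<Longrightarrow> R (c j, a + s) \<le> t (i + n)"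
      "\<And>a i. R (c j, a + s) \<le> t i \<Longrightarrow> R (c 0, a) \<le> t (i + n)"
      using walk_reach[of t p, OF step] p(1) unfolding path_between_def n_def by metis
    have gj: "g j = (c j, snd (g j))" by (simp add: c_def)
    \<comment> \<open>If \<open>p\<close> arrives at the level of \<open>g j\<close> or above, it
      has gone forward at least \<open>j\<close> greedy steps. Otherwise, read backwards from
      \<open>g j\<close>, it reaches a later copy of the start, which takes at least
      \<open>m - j\<close> steps.\<close>
    have "j \<le> n"
    proof (cases "snd (g j) \<le> s")
      case True
      have "t j \<le> R (c j, s)"
        using shift_mono[OF True] by (simp add: t_def R_def c_def)
      also have "\<dots> \<le> t (0 + n)" using s(1)[of 0 0] by (simp add: t_def c_def g0)
      finally show ?thesis using strict_mono_less_eq[OF mono] by simp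
    next
      case False
      then have "1 \<le> snd (g j) - s" by simp
      have "L (g 0) + T \<le> R (c 0, 1)" using L_le_R[of "(v0, 1)"] v0 by (simp add: L_def c_def g0)
      also have "\<dots> \<le> R (c 0, snd (g j) - s)"
        using shift_mono[OF \<open>1 \<le> snd (g j) - s\<close>] by (simp add: R_def)
      also have "\<dots> \<le> t (j + n)" by (rule s(2)) (simp add: t_def c_def)
      finally have "m \<le> j + n" by (rule m_least)
      then show ?thesis by (simp add: j_def)
    qed
    also have "n \<le> graph_diam V E"
      using p(2) graph_dist_le_diam[of "c 0" "c j"] gV by (simp add: n_def c_def)
    \<comment> \<open>\<open>Suc (Suc m) div 2\<close> is \<open>j + 1\<close>.\<close>
    finally have "Suc (Suc m) div 2 + 3 \<le> graph_diam V E + 4" by (simp add: j_def)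
    then show ?thesis using rainbow_colouring_bounds[OF nonempty f(1)] f(2) by (meson order_trans)
  qed
qed

end

lemma (in connected_min_degree_2) circular_arc_bounds:
  assumes "circular_arc_graph V E"
  shows "graph_diam V E \<le> rainbow_connection_number V E \<and>
    rainbow_connection_number V E \<le> graph_diam V E + 4"
proof -
  obtain l r :: "'a \<Rightarrow> real" where lr: "\<forall>v\<in>V. l v \<le> r v" "\<forall>u\<in>V. \<forall>v\<in>V. u \<noteq> v \<longrightarrow>
    ({u, v} \<in> E \<longleftrightarrow> (\<exists>k :: int. l u \<le> r v + 2 * pi * k \<and> l v + 2 * pi * k \<le> r u))"
    using circular_arc_closed[OF finite_V assms] by auto
  interpret circular_arcs V E l r "2 * pi"
    by unfold_locales (use lr in auto)
  show ?thesis by (rule bounds)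
qed

subsection \<open>Extremal examples\<close>

text \<open>The hubs \<open>0\<close> and \<open>1\<close> are joined to each of \<open>n\<close> leaves; \<open>F\<close> is empty or contains the edge
  between the hubs.\<close>

locale hub_graph =
  fixes n :: nat and F :: "nat set set"
  assumes n: "2 \<le> n" and F: "F \<subseteq> {{0, 1}}"
begin

definition V :: "nat set" where "V = {..<n + 2}"
definition E :: "nat set set" where "E = {{i, x} |i x. i < 2 \<and> x \<in> {2..<n + 2}} \<union> F"

lemma edge_iff:
  "{u, v} \<in> E \<longleftrightarrow> (u < 2 \<and> v \<in> {2..<n + 2}) \<or> (v < 2 \<and> u \<in> {2..<n + 2}) \<or> {u, v} \<in> F"
  by (auto simp: E_def doubleton_eq_iff)

lemma F_edge:
  assumes "{u, v} \<in> F" shows "(u = 0 \<and> v = 1) \<or> (u = 1 \<and> v = 0)"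
proof -
  have "{u, v} = {0, 1}" using subsetD[OF F assms] by (rule singletonD)
  then show ?thesis unfolding doubleton_eq_iff .
qed

lemma edge_iff_no_hub_edge:
  "F = {} \<Longrightarrow> {u, v} \<in> E \<longleftrightarrow> (u < 2 \<and> v \<in> {2..<n + 2}) \<or> (v < 2 \<and> u \<in> {2..<n + 2})"
  unfolding edge_iff by simp

lemma edge_iff_hub_edge:
  "F = {{0, 1}} \<Longrightarrow> {u, v} \<in> E \<longleftrightarrow>
    (u < 2 \<and> v \<in> {2..<n + 2}) \<or> (v < 2 \<and> u \<in> {2..<n + 2}) \<or> (u < 2 \<and> v < 2 \<and> u \<noteq> v)"
  unfolding edge_iff by (auto simp: doubleton_eq_iff less_2_cases_iff)

lemma simple: "finite_simple_graph V E"
proof -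
  have "e \<subseteq> V \<and> card e = 2" if "e \<in> E" for e
  proof -
    consider i x where "i < 2" "x \<in> {2..<n + 2}" "e = {i, x}" | "e \<in> {{0, 1}}"
    proof -
      have "(\<exists>i x. i < 2 \<and> x \<in> {2..<n + 2} \<and> e = {i, x}) \<or> e \<in> F"
        using \<open>e \<in> E\<close> unfolding E_def by blast
      then show ?thesis using that subsetD[OF F] by metis
    qed
    then show ?thesis
    proof cases
      case 1
      then have "i \<noteq> x" by auto
      then show ?thesis using 1 by (simp add: V_def)
    next
      case 2
      then show ?thesis using n by (simp add: V_def)
    qed
  qed
  then show ?thesis by (simp add: finite_simple_graph_def V_def)
qed

lemma short_path:
  assumes "u \<in> V" "v \<in> V"
  shows "\<exists>p. path_between V E u v p \<and> length p \<le> 3"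
proof -
  consider "u = v" | "u \<noteq> v" "{u, v} \<in> E" | "u \<noteq> v" "2 \<le> u" "2 \<le> v" | "u \<noteq> v" "u < 2" "v < 2"
    using assms by (force simp: edge_iff V_def)
  then show ?thesis
  proof cases
    case 1 then show ?thesis using assms by (intro exI[of _ "[u]"]) (simp add: path_between_def)
  next
    case 2 then show ?thesis using assms by (intro exI[of _ "[u, v]"]) (simp add: path_between_def)
  next
    case 3 then show ?thesis using assms n
      by (intro exI[of _ "[u, 0, v]"]) (simp add: path_between_def edge_iff V_def)
  next
    case 4 then show ?thesis using assms n
      by (intro exI[of _ "[u, 2, v]"]) (simp add: path_between_def edge_iff V_def)
  qed
qed

lemma min_degree_ge: "2 \<le> min_degree V E"
proof -
  interpret finite_graph V E by unfold_locales (rule simple)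
  have "2 \<le> card (neighbours E v)" if v: "v \<in> V" for v
  proof -
    have "\<exists>S. S \<subseteq> neighbours E v \<and> card S = 2"
    proof (cases "v < 2")
      case True
      then show ?thesis using n
        by (intro exI[of _ "{2, 3}"]) (simp add: neighbours_def edge_iff)
    next
      case False
      then show ?thesis using v
        by (intro exI[of _ "{0, 1}"]) (simp add: neighbours_def edge_iff V_def)
    qed
    then show ?thesis using card_mono[OF finite_subset[OF neighbours_subset finite_V]] by metis
  qed
  then show ?thesis unfolding min_degree_def using n by (subst Min_ge_iff) (auto simp: V_def)
qed

sublocale connected_min_degree_2 V E
proof
  show "connected_graph V E" using short_path by (fastforce simp: connected_graph_def V_def)
qed (rule simple min_degree_ge)+

lemma diam_le: "graph_diam V E \<le> 2"
proof (rule graph_diam_le[OF nonempty])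
  fix u v assume "u \<in> V" "v \<in> V"
  then obtain p where "path_between V E u v p" "length p \<le> 3" using short_path by blast
  then show "graph_dist V E u v \<le> 2" using graph_dist_le by fastforce
qed

text \<open>Both two-edge routes between the twins repeat a colour. The next possible length is
  three edges, using the edge between the hubs; without it the graph is bipartite and four are
  needed.\<close>

lemma rainbow_path_between_twins:
  assumes p: "path_between V E x y p" "distinct (map c (path_edges p))"
    and xy: "x \<in> {2..<n + 2}" "y \<in> {2..<n + 2}" "x \<noteq> y"
    and twins: "c {0, x} = c {0, y}" "c {1, x} = c {1, y}"
  shows "4 \<le> length p" "F = {} \<Longrightarrow> 5 \<le> length p"
proof -
  obtain m p1 where p1: "p = x # m # p1"
    using p(1) xy by (cases p; cases "tl p") (auto simp: path_between_def)
  have "{x, m} \<in> E" using p(1) by (simp add: p1 path_between_def)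
  then have m: "m < 2" using xy F_edge[of x m] by (auto simp: edge_iff)
  then obtain m' p2 where p2: "p1 = m' # p2"
    using p(1) xy by (cases p1) (auto simp: p1 path_between_def)
  have mm': "{m, m'} \<in> E" using p(1) by (simp add: p1 p2 path_between_def)
  have "m' \<noteq> y"
  proof
    assume "m' = y"
    then have "c {x, m} \<noteq> c {m, y}" using p(2) by (simp add: p1 p2)
    moreover have "m = 0 \<or> m = 1" using m by linarith
    ultimately show False using twins by (auto simp: insert_commute)
  qed
  then obtain m'' p3 where p3: "p2 = m'' # p3"
    using p(1) by (cases p2) (auto simp: p1 p2 path_between_def)
  show "4 \<le> length p" by (simp add: p1 p2 p3)
  assume "F = {}"
  note edge = edge_iff_no_hub_edge[OF this]
  have "2 \<le> m'" using mm' m by (auto simp: edge)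
  moreover have "{m', m''} \<in> E" using p(1) by (simp add: p1 p2 p3 path_between_def)
  ultimately have "m'' < 2" by (auto simp: edge)
  then have "p3 \<noteq> []" using p(1) xy by (auto simp: p1 p2 p3 path_between_def)
  then show "5 \<le> length p" by (cases p3) (simp_all add: p1 p2 p3)
qed

text \<open>Pigeonhole on the pair of colours at the two hubs; this is where the numbers of leaves
  \<open>5 > 2 * 2\<close> and \<open>10 > 3 * 3\<close> come from.\<close>

lemma few_colours_twins:
  assumes "card (c ` E) \<le> q" "q * q < n"
  shows "\<exists>x\<in>{2..<n + 2}. \<exists>y\<in>{2..<n + 2}. x \<noteq> y \<and> c {0, x} = c {0, y} \<and> c {1, x} = c {1, y}"
proof -
  let ?f = "\<lambda>x. (c {0, x}, c {1, x})"
  have "?f ` {2..<n + 2} \<subseteq> c ` E \<times> c ` E" by (auto simp: edge_iff)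
  then have "card (?f ` {2..<n + 2}) \<le> card (c ` E) * card (c ` E)"
    using card_mono[of "c ` E \<times> c ` E"] finite_E by (simp add: card_cartesian_product)
  also have "\<dots> \<le> q * q" using assms(1) by (simp add: mult_le_mono)
  also have "\<dots> < card {2..<n + 2}" using assms(2) by simp
  finally have "\<not> inj_on ?f {2..<n + 2}" by (rule pigeonhole)
  then show ?thesis by (auto simp: inj_on_def)
qed

lemma rainbow_ge_3:
  assumes "4 < n" shows "3 \<le> rainbow_connection_number V E"
proof (rule rainbow_connection_number_ge, rule ccontr)
  fix c :: "nat set \<Rightarrow> nat" assume rb: "rainbow_connected V E c" and "\<not> 3 \<le> card (c ` E)"
  then have few: "card (c ` E) \<le> 2" by simp
  then obtain x y where xy: "x \<in> {2..<n + 2}" "y \<in> {2..<n + 2}" "x \<noteq> y"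
      "c {0, x} = c {0, y}" "c {1, x} = c {1, y}"
    using few_colours_twins[of c 2] assms by auto
  then obtain p where p: "path_between V E x y p" "distinct (map c (path_edges p))"
    using rb by (auto simp: rainbow_connected_def V_def)
  show False using rainbow_path_between_twins(1)[OF p xy] rainbow_path_length[OF p] few by linarith
qed

lemma rainbow_ge_4:
  assumes "9 < n" "F = {}" shows "4 \<le> rainbow_connection_number V E"
proof (rule rainbow_connection_number_ge, rule ccontr)
  fix c :: "nat set \<Rightarrow> nat" assume rb: "rainbow_connected V E c" and "\<not> 4 \<le> card (c ` E)"
  then have few: "card (c ` E) \<le> 3" by simp
  then obtain x y where xy: "x \<in> {2..<n + 2}" "y \<in> {2..<n + 2}" "x \<noteq> y"
      "c {0, x} = c {0, y}" "c {1, x} = c {1, y}"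
    using few_colours_twins[of c 3] assms by auto
  then obtain p where p: "path_between V E x y p" "distinct (map c (path_edges p))"
    using rb by (auto simp: rainbow_connected_def V_def)
  show False using rainbow_path_between_twins(2)[OF p xy assms(2)] rainbow_path_length[OF p] few by linarith
qed

lemma threshold_graph:
  assumes "F = {{0, 1}}" shows "threshold_graph V E"
  unfolding threshold_graph_def
  by (rule exI[of _ "\<lambda>x. if x < 2 then 2 else 0"], rule exI[of _ 2])
    (auto simp: edge_iff_hub_edge[OF assms] V_def)

lemma interval_graph:
  assumes "F = {{0, 1}}" shows "interval_graph V E"
  unfolding interval_graph_def intersection_representation_def
  by (rule exI[of _ "\<lambda>x. if x < 2 then {2..n + 2} else {real x}"])
    (auto simp: edge_iff_hub_edge[OF assms] V_def is_interval_cc is_interval_1)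

lemma chain_graph:
  assumes "F = {}" shows "chain_graph V E"
  unfolding chain_graph_def
proof (intro exI conjI)
  show "bipartition V E {0, 1} {2..<n + 2}"
  proof -
    have "\<exists>a\<in>{0, 1}. \<exists>b\<in>{2..<n + 2}. e = {a, b}" if e: "e \<in> E" for e
    proof -
      have "e \<in> {{i, x} |i x. i < 2 \<and> x \<in> {2..<n + 2}}"
        using e unfolding E_def by (simp only: assms Un_empty_right)
      then obtain i x where "i < 2" "x \<in> {2..<n + 2}" "e = {i, x}" by (elim CollectE exE conjE)
      moreover have "i \<in> {0, 1}" using \<open>i < 2\<close> by auto
      ultimately show ?thesis by (intro bexI)
    qed
    then show ?thesis by (auto simp: bipartition_def V_def)
  qed
  have "neighbours E 0 = neighbours E 1"
    by (auto simp: neighbours_def edge_iff_no_hub_edge[OF assms])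
  then show "sorted_wrt (\<lambda>a a'. neighbours E a \<subseteq> neighbours E a') [0, 1]" by simp
qed auto

text \<open>Distinct nonadjacent vertices are both hubs or both leaves, so an independent triple
  consists of leaves, and any path leaving a leaf enters a hub, which is a neighbour of the
  third.\<close>

lemma AT_free: "AT_free V E"
proof -
  have False if AT: "asteroidal_triple V E x y z" for x y z
  proof -
    have V: "x \<in> V" "y \<in> V" "z \<in> V" "x \<noteq> y" "y \<noteq> z" "x \<noteq> z"
      and indep: "{x, y} \<notin> E" "{y, z} \<notin> E" "{x, z} \<notin> E"
      using AT by (auto simp: asteroidal_triple_def)
    have "a < 2 \<longleftrightarrow> b < 2" if "a \<in> V" "b \<in> V" "{a, b} \<notin> E" for a b
      using that by (auto simp: edge_iff V_def)
    then have "x < 2 \<longleftrightarrow> y < 2" "y < 2 \<longleftrightarrow> z < 2" using V indep by metis+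
    then have leaves: "2 \<le> x" "2 \<le> y" "2 \<le> z" using V(4-6) by linarith+
    obtain p where p: "path_between V E x y p" "set p \<inter> neighbours E z = {}"
      using AT by (auto simp: asteroidal_triple_def path_avoiding_neighbours_def)
    obtain m p1 where p1: "p = x # m # p1"
      using p(1) V by (cases p; cases "tl p") (auto simp: path_between_def)
    have "{x, m} \<in> E" using p(1) by (simp add: p1 path_between_def)
    then have "m < 2" using leaves F_edge[of x m] by (auto simp: edge_iff)
    then have "m \<in> neighbours E z" using V leaves by (auto simp: neighbours_def edge_iff V_def)
    then show False using p(2) p1 by auto
  qed
  then show ?thesis by (auto simp: AT_free_def)
qed

lemma diam_eq_2:
  assumes "F = {}" shows "graph_diam V E = 2"
proof -
  have V: "2 \<in> V" "3 \<in> V" using n by (auto simp: V_def)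
  then obtain p where p: "path_between V E 2 3 p" "length p - 1 = graph_dist V E 2 3"
    using short_path graph_dist_path by blast
  obtain m p1 where p1: "p = 2 # m # p1"
    using p(1) by (cases p; cases "tl p") (auto simp: path_between_def)
  have "{2, m} \<in> E" using p(1) by (simp add: p1 path_between_def)
  then have "m \<noteq> 3" by (auto simp: edge_iff_no_hub_edge[OF assms])
  then have "p1 \<noteq> []" using p(1) by (auto simp: p1 path_between_def)
  then have "2 \<le> graph_dist V E 2 3" using p(2) by (cases p1) (simp_all add: p1)
  then show ?thesis using graph_dist_le_diam[OF V] diam_le by linarith
qed

end

theorem theorem2:
  "(\<forall>(V :: 'a set) E.
      finite_simple_graph V E \<and> connected_graph V E \<and> min_degree V E \<ge> 2 \<longrightarrow>
        (interval_graph V E \<longrightarrow>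
           graph_diam V E \<le> rainbow_connection_number V E \<and>
           rainbow_connection_number V E \<le> graph_diam V E + 1) \<and>
        (AT_free V E \<longrightarrow>
           graph_diam V E \<le> rainbow_connection_number V E \<and>
           rainbow_connection_number V E \<le> graph_diam V E + 3) \<and>
        (threshold_graph V E \<longrightarrow>
           graph_diam V E \<le> rainbow_connection_number V E \<and>
           rainbow_connection_number V E \<le> 3) \<and>
        (chain_graph V E \<longrightarrow>
           graph_diam V E \<le> rainbow_connection_number V E \<and>
           rainbow_connection_number V E \<le> 4) \<and>
        (circular_arc_graph V E \<longrightarrow>
           graph_diam V E \<le> rainbow_connection_number V E \<and>
           rainbow_connection_number V E \<le> graph_diam V E + 4)) \<and>
   (\<exists>(V :: nat set) E.
      finite_simple_graph V E \<and> connected_graph V E \<and> min_degree V E \<ge> 2 \<and>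
      interval_graph V E \<and> rainbow_connection_number V E = graph_diam V E + 1) \<and>
   (\<exists>(V :: nat set) E.
      finite_simple_graph V E \<and> connected_graph V E \<and> min_degree V E \<ge> 2 \<and>
      threshold_graph V E \<and> rainbow_connection_number V E = 3) \<and>
   (\<exists>(V :: nat set) E.
      finite_simple_graph V E \<and> connected_graph V E \<and> min_degree V E \<ge> 2 \<and>
      chain_graph V E \<and> rainbow_connection_number V E = 4) \<and>
   (\<exists>(V :: nat set) E.
      finite_simple_graph V E \<and> connected_graph V E \<and> min_degree V E \<ge> 2 \<and>
      AT_free V E \<and> rainbow_connection_number V E = graph_diam V E + 2)"
proof (intro conjI allI impI)
  fix V :: "'a set" and E
  assume "finite_simple_graph V E \<and> connected_graph V E \<and> min_degree V E \<ge> 2"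
  then interpret connected_min_degree_2 V E by unfold_locales simp_all
  show "graph_diam V E \<le> rainbow_connection_number V E"
    "rainbow_connection_number V E \<le> graph_diam V E + 1" if "interval_graph V E"
    using interval_bounds[OF that] by auto
  show "graph_diam V E \<le> rainbow_connection_number V E"
    "rainbow_connection_number V E \<le> graph_diam V E + 3" if "AT_free V E"
    using AT_free_bounds[OF that] by auto
  show "graph_diam V E \<le> rainbow_connection_number V E"
    "rainbow_connection_number V E \<le> 3" if "threshold_graph V E"
    using threshold_bounds[OF that] by auto
  show "graph_diam V E \<le> rainbow_connection_number V E"
    "rainbow_connection_number V E \<le> 4" if "chain_graph V E"
    using chain_bounds[OF that] by auto
  show "graph_diam V E \<le> rainbow_connection_number V E"
    "rainbow_connection_number V E \<le> graph_diam V E + 4" if "circular_arc_graph V E"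
    using circular_arc_bounds[OF that] by auto
next
  interpret K: hub_graph 5 "{{0, 1}}" by unfold_locales simp_all
  have rc: "rainbow_connection_number K.V K.E = 3"
    using K.threshold_bounds[OF K.threshold_graph] K.rainbow_ge_3 by simp
  \<comment> \<open>Together with \<open>rc\<close> and \<open>diam_le\<close>, the interval bound
    forces the diameter to be exactly 2.\<close>
  have "rainbow_connection_number K.V K.E = graph_diam K.V K.E + 1"
    using K.interval_bounds[OF K.interval_graph] K.diam_le rc by simp
  then show "\<exists>(V :: nat set) E.
      finite_simple_graph V E \<and> connected_graph V E \<and> min_degree V E \<ge> 2 \<and>
      interval_graph V E \<and> rainbow_connection_number V E = graph_diam V E + 1"
    using K.simple K.conn K.min_degree_ge K.interval_graph by blast
  show "\<exists>(V :: nat set) E.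
      finite_simple_graph V E \<and> connected_graph V E \<and> min_degree V E \<ge> 2 \<and>
      threshold_graph V E \<and> rainbow_connection_number V E = 3"
    using K.simple K.conn K.min_degree_ge K.threshold_graph rc by blast
next
  interpret K: hub_graph 10 "{}" by unfold_locales simp_all
  have rc: "rainbow_connection_number K.V K.E = 4"
    using K.chain_bounds[OF K.chain_graph] K.rainbow_ge_4 by simp
  then show "\<exists>(V :: nat set) E.
      finite_simple_graph V E \<and> connected_graph V E \<and> min_degree V E \<ge> 2 \<and>
      chain_graph V E \<and> rainbow_connection_number V E = 4"
    using K.simple K.conn K.min_degree_ge K.chain_graph by blast
  \<comment> \<open>The chain example is reused for the AT-free case, its diameter being 2.\<close>
  have "rainbow_connection_number K.V K.E = graph_diam K.V K.E + 2"
    using rc K.diam_eq_2 by simp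
  then show "\<exists>(V :: nat set) E.
      finite_simple_graph V E \<and> connected_graph V E \<and> min_degree V E \<ge> 2 \<and>
      AT_free V E \<and> rainbow_connection_number V E = graph_diam V E + 2"
    using K.simple K.conn K.min_degree_ge K.AT_free by blast
qed

end
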